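(* For any integers $s,M>0$, there exists a $0$-generic star graph with $s+1$ edges such that for every $L\leq M$ there exists a linear combination of the first $L$ eigenfunctions of $-\frac{\partial^2}{\partial x^2}$ on this graph having exactly $L-1+(L-1)(s-1)$ zeroes.
   Context: A star graph with $s+1$ edges is a metric graph with one central vertex joined to $s+1$ degree-one vertices by edges of finite lengths. The operator $-\frac{d^2}{dx^2}$ acts edgewise with Dirichlet conditions ($f=0$) at the degree-one vertices and Neumann–Kirchhoff conditions at the central vertex (continuity, and the sum over incident edges of outgoing derivatives equals zero). Its eigenvalues $\lambda_1\le\lambda_2\le\dots$ are counted with multiplicity, with $L^2$-orthogonal eigenfunctions $f_1,f_2,\dots$. The graph is $0$-generic if no eigenfunction of this operator vanishes at an inner (degree $\ge2$) vertex. Zeroes are counted on the graph excluding the degree-one (boundary) vertices. *)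

theory Defs
  imports "HOL-Analysis.Analysis"
begin

text \<open>Star graph with s+1 edges indexed 0..s; edge j is parametrised by x in [0, l j],
  with x = 0 the central vertex and x = l j the degree-one vertex.
  A function on the graph is f :: nat => real => real, f j x being its value on edge j.\<close>

definition star_lengths :: "nat \<Rightarrow> (nat \<Rightarrow> real) \<Rightarrow> bool" where
  "star_lengths s l \<longleftrightarrow> (\<forall>j\<le>s. 0 < l j)"

definition graph_eq :: "nat \<Rightarrow> (nat \<Rightarrow> real) \<Rightarrow> (nat \<Rightarrow> real \<Rightarrow> real) \<Rightarrow> (nat \<Rightarrow> real \<Rightarrow> real) \<Rightarrow> bool" where
  "graph_eq s l f g \<longleftrightarrow> (\<forall>j\<le>s. \<forall>x\<in>{0..l j}. f j x = g j x)"

definition is_eigenfunction :: "nat \<Rightarrow> (nat \<Rightarrow> real) \<Rightarrow> real \<Rightarrow> (nat \<Rightarrow> real \<Rightarrow> real) \<Rightarrow> bool" where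
  "is_eigenfunction s l lam f \<longleftrightarrow>
     \<not> graph_eq s l f (\<lambda>_ _. 0) \<and>
     (\<exists>d dd. (\<forall>j\<le>s. \<forall>x\<in>{0..l j}.
                (f j has_real_derivative d j x) (at x within {0..l j}) \<and>
                (d j has_real_derivative dd j x) (at x within {0..l j}) \<and>
                - dd j x = lam * f j x) \<and>
             (\<Sum>j\<le>s. d j 0) = 0) \<and>
     (\<forall>j\<le>s. f j (l j) = 0) \<and>
     (\<forall>j\<le>s. f j 0 = f 0 0)"

definition zero_generic :: "nat \<Rightarrow> (nat \<Rightarrow> real) \<Rightarrow> bool" where
  "zero_generic s l \<longleftrightarrow> (\<forall>lam f. is_eigenfunction s l lam f \<longrightarrow> f 0 0 \<noteq> 0)"

definition graph_inner :: "nat \<Rightarrow> (nat \<Rightarrow> real) \<Rightarrow> (nat \<Rightarrow> real \<Rightarrow> real) \<Rightarrow> (nat \<Rightarrow> real \<Rightarrow> real) \<Rightarrow> real" where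
  "graph_inner s l f g = (\<Sum>j\<le>s. integral {0..l j} (\<lambda>x. f j x * g j x))"

text \<open>(Lam, F) is a complete L^2-orthogonal system of eigenfunctions with eigenvalues
  listed in nondecreasing order and counted with multiplicity.\<close>
definition eigen_enumeration :: "nat \<Rightarrow> (nat \<Rightarrow> real) \<Rightarrow> (nat \<Rightarrow> real) \<Rightarrow> (nat \<Rightarrow> nat \<Rightarrow> real \<Rightarrow> real) \<Rightarrow> bool" where
  "eigen_enumeration s l Lam F \<longleftrightarrow>
     mono Lam \<and>
     (\<forall>k. is_eigenfunction s l (Lam k) (F k)) \<and>
     (\<forall>k k'. k \<noteq> k' \<longrightarrow> graph_inner s l (F k) (F k') = 0) \<and>
     (\<forall>mu g. is_eigenfunction s l mu g \<longrightarrow>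
        (\<exists>K c. finite K \<and> (\<forall>k\<in>K. Lam k = mu) \<and>
               graph_eq s l g (\<lambda>j x. \<Sum>k\<in>K. c k * F k j x)))"

text \<open>Points of the graph excluding the degree-one vertices: the centre, represented by (0,0),
  and the interior points (j,x), 0 < x < l j, of the edges.\<close>
definition graph_points :: "nat \<Rightarrow> (nat \<Rightarrow> real) \<Rightarrow> (nat \<times> real) set" where
  "graph_points s l = {(0, 0)} \<union> {(j, x). j \<le> s \<and> 0 < x \<and> x < l j}"

definition zero_set :: "nat \<Rightarrow> (nat \<Rightarrow> real) \<Rightarrow> (nat \<Rightarrow> real \<Rightarrow> real) \<Rightarrow> (nat \<times> real) set" where
  "zero_set s l f = {p \<in> graph_points s l. f (fst p) (snd p) = 0}"

definition has_exactly_zeros :: "nat \<Rightarrow> (nat \<Rightarrow> real) \<Rightarrow> (nat \<Rightarrow> real \<Rightarrow> real) \<Rightarrow> nat \<Rightarrow> bool" where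
  "has_exactly_zeros s l f n \<longleftrightarrow> finite (zero_set s l f) \<and> card (zero_set s l f) = n"

end

theory Submission
  imports Defs
begin

text \<open>
  Take one edge of length 1 and s short edges. When the short edges have equal length, identifying
  them folds the star into a weighted Sturm--Liouville problem on an interval, where a nontrivial
  combination of the first L modes has at most L - 1 zeros (by repeated Darboux transforms and
  Rolle's theorem). Hence one can prescribe L - 1 sign changes on the short edge, and then all zeros
  are used up: nothing vanishes at the centre or on the long edge, and the derivative at the far
  end is nonzero. Unfolding gives L - 1 sign changes on each of the s short edges. These
  properties are open, so they survive shrinking the short edges slightly to lengths
  proportional to u, u^2, ..., u^s with u < 1 near 1 and all powers of u irrational. The edge
  lengths are then pairwise incommensurable, which makes the star 0-generic and its spectrum
  simple; on each short edge the frequencies form a Chebyshev system, so no further zeros appear.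
\<close>

section \<open>Zero counts for weighted Sturm--Liouville systems\<close>

text \<open>Two obstacles shape the construction. The equal-length star cannot itself be the answer:
  for s \<ge> 2 it has eigenfunctions that live on two short edges and vanish at the centre. Only
  its modes symmetric in the short edges are followed, and they are found as roots of a secular
  equation that makes sense for all lengths. Short edges of length below 1/M push every positive
  pole of their cotangents beyond pi*M, so each interval (pi*k, pi*(k+1)) with k < M holds exactly
  one root, for equal and for unequal short edges alike. The other obstacle is the Dirichlet end of
  the long edge. Every combination vanishes there, so uniform closeness alone would let a new zero
  enter through that end. Hence the zero count has a sharpened form in which a vanishing end
  derivative uses up one more zero. The coefficients are chosen on the equal-length star and kept
  while the lengths move. On a short edge only the lower bound for the number of zeros needs the
  perturbation argument; the upper bound L - 1 holds for every nontrivial choice of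
  coefficients.\<close>

definition zeros :: "real \<Rightarrow> real \<Rightarrow> (real \<Rightarrow> real) \<Rightarrow> real set" where
  "zeros a b f = {x \<in> {a<..<b}. f x = 0}"

section \<open>Rolle's theorem with a positive weight and one exceptional point\<close>

lemma increasing_off_point:
  fixes u v :: "real \<Rightarrow> real"
  assumes "x < y" and cont: "continuous_on {x..y} u"
    and der: "\<And>t. t \<in> {x<..<y} \<Longrightarrow> t \<noteq> c \<Longrightarrow> (u has_real_derivative v t) (at t)"
    and pos: "\<And>t. t \<in> {x<..<y} \<Longrightarrow> v t > 0"
  shows "u x < u y"
proof -
  have piece: "u p < u q" if "x \<le> p" "p < q" "q \<le> y" "c \<notin> {p<..<q}" for p q
  proof (rule DERIV_pos_imp_increasing_open[OF that(2)])
    fix t assume t: "p < t" "t < q"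
    then have "t \<in> {x<..<y}" "t \<noteq> c" using that by auto
    then show "\<exists>z. (u has_real_derivative z) (at t) \<and> 0 < z" using der pos by blast
  next
    show "continuous_on {p..q} u"
      by (rule continuous_on_subset[OF cont]) (use that in simp)
  qed
  show ?thesis
  proof (cases "c \<in> {x<..<y}")
    case True
    then have "u x < u c" "u c < u y" by (auto intro!: piece)
    then show ?thesis by simp
  qed (use \<open>x < y\<close> in \<open>auto intro!: piece\<close>)
qed

text \<open>If \<open>h\<close> had no zero, it would keep one sign by connectedness, and
  \<open>u\<close> times that sign would increase strictly, against \<open>u x = u y\<close>. A zero
  of \<open>h\<close>, not of the derivative, is sought because the weight \<open>\<rho>\<close> may
  jump at \<open>c\<close>.\<close>

lemma rolle_weighted:
  fixes u h \<rho> :: "real \<Rightarrow> real"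
  assumes "x < y" and cont: "continuous_on {x..y} u" and eq: "u x = u y"
    and der: "\<And>t. t \<in> {x<..<y} \<Longrightarrow> t \<noteq> c \<Longrightarrow> (u has_real_derivative \<rho> t * h t) (at t)"
    and pos: "\<And>t. t \<in> {x<..<y} \<Longrightarrow> \<rho> t > 0"
    and h: "continuous_on {x<..<y} h"
  shows "\<exists>z\<in>{x<..<y}. h z = 0"
proof (rule ccontr)
  assume no: "\<not> ?thesis"
  define m where "m = (x + y) / 2"
  have m: "m \<in> {x<..<y}" using \<open>x < y\<close> by (simp add: m_def)
  have sgn: "h t * h m > 0" if t: "t \<in> {x<..<y}" for t
  proof (rule ccontr)
    assume "\<not> ?thesis"
    then have neg: "h t * h m < 0" using no t m by (smt (verit) mult_eq_0_iff)
    have conn: "connected (h ` {x<..<y})"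
      by (intro connected_continuous_image h) auto
    have "0 \<in> h ` {x<..<y}"
    proof (cases "h t < 0")
      case True
      then have "0 < h m" using neg by (simp add: mult_less_0_iff)
      then show ?thesis using connectedD_interval[OF conn, of "h t" "h m" 0] t m True by auto
    next
      case False
      then have "0 < h t" "h m < 0" using neg by (auto simp: mult_less_0_iff)
      then show ?thesis using connectedD_interval[OF conn, of "h m" "h t" 0] t m by auto
    qed
    then show False using no by auto
  qed
  have "u x * h m < u y * h m"
  proof (rule increasing_off_point[where u = "\<lambda>t. u t * h m" and v = "\<lambda>t. \<rho> t * (h t * h m)" and c = c])
    show "continuous_on {x..y} (\<lambda>t. u t * h m)" by (intro continuous_intros cont)
    show "((\<lambda>t. u t * h m) has_real_derivative \<rho> t * (h t * h m)) (at t)"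
      if "t \<in> {x<..<y}" "t \<noteq> c" for t
      using DERIV_cmult_right[OF der[OF that], of "h m"] by (simp add: mult_ac)
    show "\<rho> t * (h t * h m) > 0" if "t \<in> {x<..<y}" for t
      using pos[OF that] sgn[OF that] by simp
  qed fact
  then show False using eq by simp
qed

text \<open>Each new largest point of \<open>Z\<close> yields a zero of \<open>h\<close> between it
  and the previous maximum, hence above all zeros collected so far. The interval \<open>I\<close>
  may contain \<open>a\<close> or \<open>b\<close>, so that zeros attained only at an end enter the
  count.\<close>

lemma rolle_count:
  fixes u h \<rho> :: "real \<Rightarrow> real"
  assumes Z: "finite Z" "Z \<subseteq> I" "\<And>x. x \<in> Z \<Longrightarrow> u x = 0"
    and I: "is_interval I" "I \<subseteq> {a..b}" and cont: "continuous_on I u"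
    and der: "\<And>t. t \<in> {a<..<b} \<Longrightarrow> t \<noteq> c \<Longrightarrow> (u has_real_derivative \<rho> t * h t) (at t)"
    and pos: "\<And>t. t \<in> {a<..<b} \<Longrightarrow> \<rho> t > 0"
    and h: "continuous_on {a<..<b} h" and fin: "finite (zeros a b h)"
  shows "card Z \<le> card (zeros a b h) + 1"
proof -
  have "Z \<noteq> {} \<longrightarrow> (\<exists>Y. Y \<subseteq> zeros a b h \<and> card Y + 1 = card Z \<and> (\<forall>y\<in>Y. y < Max Z))"
    using Z
  proof (induction Z rule: finite_linorder_max_induct)
    case empty
    then show ?case by simp
  next
    case (insert y A)
    have card_ins: "card (insert y A) = card A + 1" and max_ins: "Max (insert y A) = y"
      using insert.hyps by (auto intro!: Max_eqI simp: less_imp_le)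
    show ?case
    proof (cases "A = {}")
      case True
      then show ?thesis by (auto intro!: exI[of _ "{}"])
    next
      case False
      with insert obtain Y where Y: "Y \<subseteq> zeros a b h" "card Y + 1 = card A" "\<forall>y\<in>Y. y < Max A"
        by auto
      let ?x = "Max A"
      have xA: "?x \<in> A" using False insert.hyps by simp
      have xy: "?x < y" using insert.hyps xA by auto
      have xI: "?x \<in> I" "y \<in> I" using insert.prems xA by auto
      have sub: "{?x..y} \<subseteq> I" 
      proof
        fix t assume "t \<in> {?x..y}"
        then show "t \<in> I" using mem_is_interval_1_I[OF I(1) xI] by simp
      qed
      have sub2: "{?x<..<y} \<subseteq> {a<..<b}"
        using subsetD[OF I(2) xI(1)] subsetD[OF I(2) xI(2)] by auto
      have "\<exists>z\<in>{?x<..<y}. h z = 0"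
        by (rule rolle_weighted[where u = u and \<rho> = \<rho> and c = c])
          (use xy xA insert.prems(2) continuous_on_subset[OF cont sub] continuous_on_subset[OF h sub2] der[OF subsetD[OF sub2]] pos[OF subsetD[OF sub2]] in simp_all)
      then obtain z where z: "?x < z" "z < y" "h z = 0" by auto
      have zz: "z \<in> zeros a b h" using z sub2 by (auto simp: zeros_def)
      have nz: "z \<notin> Y" using Y(3) z by auto
      have finY: "finite Y" using Y(1) fin finite_subset by auto
      show ?thesis unfolding card_ins max_ins
        by (rule impI, rule exI[of _ "insert z Y"]) (use Y zz nz finY z xy in auto)
    qed
  qed
  then show ?thesis
    using card_mono[OF fin] by (cases "Z = {}") fastforce+
qed

lemma finite_zerosI:
  assumes "\<And>Z. finite Z \<Longrightarrow> Z \<subseteq> zeros a b f \<Longrightarrow> card Z \<le> n"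
  shows "finite (zeros a b f) \<and> card (zeros a b f) \<le> n"
  using finite_if_finite_subsets_card_bdd[of "zeros a b f" n] assms by blast

section \<open>End behaviour and Darboux transforms\<close>

lemma eventually_nonzero_right:
  assumes "finite (zeros a b f)" "a < b"
  shows "eventually (\<lambda>x. f x \<noteq> 0) (at_right a)"
proof -
  have "eventually (\<lambda>x. x \<notin> zeros a b f) (at_right a)"
    using islimpt_finite[OF assms(1)] by (auto simp: islimpt_iff_eventually eventually_at_split)
  moreover have "eventually (\<lambda>x. x \<in> {a<..<b}) (at_right a)"
    using eventually_at_right_real[OF assms(2)] .
  ultimately show ?thesis by eventually_elim (auto simp: zeros_def)
qed

lemma eventually_nonzero_left:
  assumes "finite (zeros a b f)" "a < b"
  shows "eventually (\<lambda>x. f x \<noteq> 0) (at_left b)"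
proof -
  have "eventually (\<lambda>x. x \<notin> zeros a b f) (at_left b)"
    using islimpt_finite[OF assms(1)] by (auto simp: islimpt_iff_eventually eventually_at_split)
  moreover have "eventually (\<lambda>x. x \<in> {a<..<b}) (at_left b)"
    using eventually_at_left_real[OF assms(2)] .
  ultimately show ?thesis by eventually_elim (auto simp: zeros_def)
qed

text \<open>The conditions are chosen to reproduce themselves under the Darboux transform. The first
  clause makes the Wronskians vanish at the end; the convergent ratios become the limits of the new
  fluxes. A filter stands for the end so that left and right are treated together.\<close>

definition end_regular :: "real filter \<Rightarrow> nat \<Rightarrow> (nat \<Rightarrow> real \<Rightarrow> real) \<Rightarrow> (nat \<Rightarrow> real \<Rightarrow> real) \<Rightarrow> bool" where
  "end_regular G N f q \<longleftrightarrow>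
     (\<forall>k<N. (f k \<longlongrightarrow> 0) G \<and> (\<exists>z. (q k \<longlongrightarrow> z) G)) \<and>
     (\<forall>k<N. \<forall>j<N. \<exists>z. ((\<lambda>x. f k x / f j x) \<longlongrightarrow> z) G)"

text \<open>
  The functions solve f' = \<alpha> q and q' = - lam \<beta> f away from one point c, where the weights may jump.
  With r true both ends are Dirichlet ends and the k-th function has at most k zeros. With r
  false only the left end is constrained and no function vanishes in the interior.
\<close>

definition sl_system :: "bool \<Rightarrow> real \<Rightarrow> real \<Rightarrow> real \<Rightarrow> (real \<Rightarrow> real) \<Rightarrow> (real \<Rightarrow> real) \<Rightarrow>
    nat \<Rightarrow> (nat \<Rightarrow> real) \<Rightarrow> (nat \<Rightarrow> real \<Rightarrow> real) \<Rightarrow> (nat \<Rightarrow> real \<Rightarrow> real) \<Rightarrow> bool" where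
  "sl_system r a b c \<alpha> \<beta> N lam f q \<longleftrightarrow>
     a < c \<and> c < b \<and> (\<forall>x\<in>{a<..<b}. 0 < \<alpha> x \<and> 0 < \<beta> x) \<and>
     (\<forall>k<N. continuous_on {a<..<b} (f k) \<and> continuous_on {a<..<b} (q k) \<and>
        (\<forall>x\<in>{a<..<b} - {c}. (f k has_real_derivative \<alpha> x * q k x) (at x) \<and>
           (q k has_real_derivative - lam k * \<beta> x * f k x) (at x))) \<and>
     (\<forall>k<N. finite (zeros a b (f k)) \<and> card (zeros a b (f k)) \<le> (if r then k else 0)) \<and>
     inj_on lam {..<N} \<and>
     end_regular (at_right a) N f q \<and> (r \<longrightarrow> end_regular (at_left b) N f q)"

text \<open>
  The Wronskians with the ground state again form such a system, with one function fewer and with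
  weights \<beta> f0^2 and \<alpha> / f0^2, and the k-th one has lost a zero.
\<close>

definition darboux :: "(nat \<Rightarrow> real \<Rightarrow> real) \<Rightarrow> (nat \<Rightarrow> real \<Rightarrow> real) \<Rightarrow> nat \<Rightarrow> real \<Rightarrow> real" where
  "darboux f q k x = f 0 x * q (Suc k) x - f (Suc k) x * q 0 x"

lemma sl_system_nonzero:
  assumes "sl_system r a b c \<alpha> \<beta> (Suc N) lam f q" "x \<in> {a<..<b}"
  shows "f 0 x \<noteq> 0"
proof -
  have "finite (zeros a b (f 0))" "card (zeros a b (f 0)) \<le> 0"
    using assms(1) unfolding sl_system_def by (cases r, auto)+
  then show ?thesis using assms(2) by (auto simp: zeros_def)
qed

text \<open>The products of fluxes cancel, so that only the gap between the two eigenvalues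
  survives.\<close>

lemma darboux_deriv:
  assumes "sl_system r a b c \<alpha> \<beta> (Suc N) lam f q" "k < N" "x \<in> {a<..<b}" "x \<noteq> c"
  shows "(darboux f q k has_real_derivative
           \<beta> x * ((lam 0 - lam (Suc k)) * f 0 x * f (Suc k) x)) (at x)"
proof -
  have d: "(f 0 has_real_derivative \<alpha> x * q 0 x) (at x)" "(q 0 has_real_derivative - lam 0 * \<beta> x * f 0 x) (at x)"
    "(f (Suc k) has_real_derivative \<alpha> x * q (Suc k) x) (at x)"
    "(q (Suc k) has_real_derivative - lam (Suc k) * \<beta> x * f (Suc k) x) (at x)"
    using assms unfolding sl_system_def by auto
  show ?thesis unfolding darboux_def[abs_def]
    by (rule derivative_eq_intros d refl)+ (simp add: algebra_simps)
qed

lemma darboux_tendsto_0: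
  assumes "end_regular G (Suc N) f q" "k < N"
  shows "(darboux f q k \<longlongrightarrow> 0) G"
proof -
  have f0: "(f 0 \<longlongrightarrow> 0) G" "(f (Suc k) \<longlongrightarrow> 0) G"
    using assms unfolding end_regular_def by auto
  obtain y z where "(q 0 \<longlongrightarrow> y) G" "(q (Suc k) \<longlongrightarrow> z) G"
    using assms unfolding end_regular_def by blast
  from tendsto_diff[OF tendsto_mult[OF f0(1) this(2)] tendsto_mult[OF f0(2) this(1)]]
  show ?thesis unfolding darboux_def[abs_def] by simp
qed

text \<open>The derivative of the Wronskian has, up to a positive weight, the zeros of
  \<open>f (Suc k)\<close>, while the Wronskian itself also vanishes at the constrained ends. Rolle
  gives \<open>card Z + 2 \<le> (k + 1) + 1\<close> with two such ends, and
  \<open>card Z + 1 \<le> 0 + 1\<close> with one.\<close>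

lemma sl_darboux_zeros:
  assumes sys: "sl_system r a b c \<alpha> \<beta> (Suc N) lam f q" and k: "k < N"
  shows "finite (zeros a b (darboux f q k)) \<and>
         card (zeros a b (darboux f q k)) \<le> (if r then k else 0)"
proof (rule finite_zerosI)
  fix Z assume Z: "finite Z" "Z \<subseteq> zeros a b (darboux f q k)"
  let ?w = "darboux f q k"
  let ?h = "\<lambda>x. (lam 0 - lam (Suc k)) * f 0 x * f (Suc k) x"
  have ab: "a < b" using sys unfolding sl_system_def by linarith
  have inj: "lam 0 \<noteq> lam (Suc k)"
    using sys k inj_onD[of lam "{..<Suc N}" 0 "Suc k"] by (auto simp: sl_system_def)
  note f0 = sl_system_nonzero[OF sys]
  have "zeros a b ?h = zeros a b (f (Suc k))"
    using inj f0 by (auto simp: zeros_def)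
  then have zh: "finite (zeros a b ?h)" "card (zeros a b ?h) \<le> (if r then Suc k else 0)"
    using sys k unfolding sl_system_def by auto
  have conth: "continuous_on {a<..<b} ?h"
    using sys k unfolding sl_system_def by (auto intro!: continuous_intros)
  have contw: "continuous_on {a<..<b} ?w"
    using sys k unfolding sl_system_def darboux_def[abs_def] by (auto intro!: continuous_intros)
  have la: "(?w \<longlongrightarrow> 0) (at_right a)"
    by (rule darboux_tendsto_0[OF _ k]) (use sys in \<open>auto simp: sl_system_def\<close>)
  \<comment> \<open>Without \<open>r\<close> the right end stays outside, since no limit is known
    there.\<close>
  define I where "I = (if r then {a..b} else {a..<b})"
  define u where "u x = (if x \<in> {a<..<b} then ?w x else 0)" for x
  have u_near: "eventually (\<lambda>y. u y = ?w y) (nhds x)" if "x \<in> {a<..<b}" for x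
    using eventually_nhds_in_open[OF open_greaterThanLessThan that]
    by eventually_elim (auto simp: u_def)
  have at_int: "(u \<longlongrightarrow> u x) (at x)" if "x \<in> {a<..<b}" for x
  proof -
    have "(?w \<longlongrightarrow> ?w x) (at x)"
      using contw that by (simp add: continuous_on_eq_continuous_at isCont_def)
    then show ?thesis
      using Lim_transform_eventually eventually_nhds_conv_at u_near[OF that] that
      by (smt (verit, best) eventually_mono u_def)
  qed
  have ua: "(u \<longlongrightarrow> 0) (at_right a)"
    by (rule Lim_transform_eventually[OF la])
      (use eventually_at_right_real[OF ab] in eventually_elim, auto simp: u_def)
  have ub: "(u \<longlongrightarrow> 0) (at_left b)" if r
  proof -
    have lb: "(?w \<longlongrightarrow> 0) (at_left b)"
      by (rule darboux_tendsto_0[OF _ k]) (use sys that in \<open>auto simp: sl_system_def\<close>)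
    show ?thesis
      by (rule Lim_transform_eventually[OF lb])
        (use eventually_at_left_real[OF ab] in eventually_elim, auto simp: u_def)
  qed
  have uab: "u a = 0" "u b = 0" by (auto simp: u_def)
  have contu: "continuous_on I u"
  proof (cases r)
    case True
    have "continuous_on {a..b} u"
      using ab ua ub[OF True] uab at_int by (intro continuous_on_IccI) auto
    then show ?thesis using True by (simp add: I_def)
  next
    case False
    have "continuous_on {a..<b} u"
      unfolding continuous_on_def
    proof
      fix x assume x: "x \<in> {a..<b}"
      show "(u \<longlongrightarrow> u x) (at x within {a..<b})"
      proof (cases "x = a")
        case True
        have "(u \<longlongrightarrow> u a) (at_right a)" using ua uab by simp
        moreover have "at a within {a..<b} \<le> at_right a"
          unfolding at_within_def by (intro inf_mono) auto
        ultimately show ?thesis using True tendsto_mono by blast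
      next
        case False
        then show ?thesis using tendsto_within_subset[OF at_int[of x], of "{a..<b}"] x by auto
      qed
    qed
    then show ?thesis using False by (simp add: I_def)
  qed
  define E where "E = (if r then {a, b} else {a})"
  have card_E: "card E = (if r then 2 else 1)" using ab by (auto simp: E_def)
  have disj: "Z \<inter> E = {}" using Z by (auto simp: E_def zeros_def)
  have "card (Z \<union> E) \<le> card (zeros a b ?h) + 1"
  proof (rule rolle_count[where u = u and \<rho> = \<beta> and c = c and I = I])
    show "finite (Z \<union> E)" using Z by (auto simp: E_def)
    show "Z \<union> E \<subseteq> I" using Z ab by (auto simp: E_def I_def zeros_def)
    show "u x = 0" if "x \<in> Z \<union> E" for x
      using that Z by (auto simp: u_def E_def zeros_def split: if_splits)
    show "is_interval I" by (auto simp: I_def is_interval_1)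
    show "I \<subseteq> {a..b}" by (auto simp: I_def)
    show "(u has_real_derivative \<beta> t * ?h t) (at t)" if "t \<in> {a<..<b}" "t \<noteq> c" for t
      using darboux_deriv[OF sys k that] DERIV_cong_ev[OF refl u_near[OF that(1)] refl] by simp
    show "\<beta> t > 0" if "t \<in> {a<..<b}" for t using sys that by (auto simp: sl_system_def)
  qed (use contu conth zh in auto)
  moreover have "card (Z \<union> E) = card Z + card E"
    using disj Z by (intro card_Un_disjoint) (auto simp: E_def)
  ultimately show "card Z \<le> (if r then k else 0)"
    using zh card_E by (auto split: if_splits)
qed

text \<open>The ratio of two Wronskians has the form 0/0 at the end. The ratio of their derivatives
  is a constant times \<open>f (Suc k) / f (Suc j)\<close>, which converges by assumption, so
  l'Hospital's rule carries the ratio condition over.\<close>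

lemma end_regular_darboux:
  assumes sys: "sl_system r a b c \<alpha> \<beta> (Suc N) lam f q"
    and reg: "end_regular G (Suc N) f q" and G: "G = at_right a \<or> G = at_left b"
  shows "end_regular G N (darboux f q) (\<lambda>k x. (lam 0 - lam (Suc k)) * f (Suc k) x / f 0 x)"
proof -
  have acb: "a < c" "c < b" "a < b" using sys unfolding sl_system_def by linarith+
  have nz: "eventually (\<lambda>x. u x \<noteq> 0) G" if "finite (zeros a b u)" for u
    using G eventually_nonzero_right[OF that acb(3)] eventually_nonzero_left[OF that acb(3)] by auto
  have nz_f: "eventually (\<lambda>x. f k x \<noteq> 0) G" if "k < Suc N" for k
    using nz sys that unfolding sl_system_def by auto
  have nz_w: "eventually (\<lambda>x. darboux f q k x \<noteq> 0) G" if "k < N" for k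
    using nz sl_darboux_zeros[OF sys that] by auto
  have near: "eventually (\<lambda>x. x \<in> {a<..<b} \<and> x \<noteq> c) G"
    using G
  proof
    assume "G = at_right a"
    then show ?thesis using eventually_at_right_real[OF acb(1)] acb by (auto elim: eventually_mono)
  next
    assume "G = at_left b"
    then show ?thesis using eventually_at_left_real[OF acb(2)] acb by (auto elim: eventually_mono)
  qed
  let ?d = "\<lambda>k x. \<beta> x * ((lam 0 - lam (Suc k)) * f 0 x * f (Suc k) x)"
  have lam_ne: "lam 0 \<noteq> lam (Suc k)" if "k < N" for k
    using sys that inj_onD[of lam "{..<Suc N}" 0 "Suc k"] by (auto simp: sl_system_def)
  have der: "eventually (\<lambda>x. DERIV (darboux f q k) x :> ?d k x) G" if "k < N" for k
    using near by eventually_elim (use darboux_deriv[OF sys that] in auto)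
  have \<beta>: "eventually (\<lambda>x. \<beta> x \<noteq> 0) G"
  proof -
    have "\<beta> x > 0" if "x \<in> {a<..<b}" for x using sys that unfolding sl_system_def by blast
    then have "\<beta> x \<noteq> 0" if "x \<in> {a<..<b}" for x using that by (metis less_irrefl)
    then show ?thesis by (intro eventually_mono[OF near]) blast
  qed
  have d_nz: "eventually (\<lambda>x. ?d k x \<noteq> 0) G" if "k < N" for k
    using \<beta> nz_f[OF zero_less_Suc] nz_f[OF Suc_mono[OF that]]
    by eventually_elim (use lam_ne[OF that] in auto)
  have ratio: "\<exists>z. ((\<lambda>x. darboux f q k x / darboux f q j x) \<longlongrightarrow> z) G" if kj: "k < N" "j < N" for k j
  proof -
    obtain z where "((\<lambda>x. f (Suc k) x / f (Suc j) x) \<longlongrightarrow> z) G"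
      using reg kj unfolding end_regular_def by (meson Suc_less_eq)
    then have "((\<lambda>x. (lam 0 - lam (Suc k)) / (lam 0 - lam (Suc j)) * (f (Suc k) x / f (Suc j) x))
        \<longlongrightarrow> (lam 0 - lam (Suc k)) / (lam 0 - lam (Suc j)) * z) G" (is "(_ \<longlongrightarrow> ?l) G")
      by (intro tendsto_intros)
    moreover have "eventually (\<lambda>x. (lam 0 - lam (Suc k)) / (lam 0 - lam (Suc j)) * (f (Suc k) x / f (Suc j) x)
        = ?d k x / ?d j x) G"
      using \<beta> nz_f[OF zero_less_Suc]
      by eventually_elim (use lam_ne[OF kj(1)] lam_ne[OF kj(2)] in auto)
    ultimately have lim: "((\<lambda>x. ?d k x / ?d j x) \<longlongrightarrow> ?l) G"
      by (rule Lim_transform_eventually)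
    note facts = darboux_tendsto_0[OF reg kj(1)] darboux_tendsto_0[OF reg kj(2)]
      nz_w[OF kj(2)] d_nz[OF kj(2)] der[OF kj(1)] der[OF kj(2)] lim
    from G have "((\<lambda>x. darboux f q k x / darboux f q j x) \<longlongrightarrow> ?l) G"
    proof
      assume G': "G = at_right a"
      show ?thesis unfolding G' by (rule lhopital_right[OF facts[unfolded G']])
    next
      assume G': "G = at_left b"
      show ?thesis unfolding G' by (rule lhopital_left[OF facts[unfolded G']])
    qed
    then show ?thesis by blast
  qed
  have "\<exists>z. ((\<lambda>x. (lam 0 - lam (Suc k)) * f (Suc k) x / f 0 x) \<longlongrightarrow> z) G" if k: "k < N" for k
  proof -
    obtain z where "((\<lambda>x. f (Suc k) x / f 0 x) \<longlongrightarrow> z) G"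
      using reg k unfolding end_regular_def by (meson Suc_less_eq zero_less_Suc)
    from tendsto_mult_left[OF this, of "lam 0 - lam (Suc k)"] show ?thesis by auto
  qed
  then show ?thesis
    unfolding end_regular_def using darboux_tendsto_0[OF reg] ratio by auto
qed

text \<open>The system closes because the derivative of \<open>f (Suc k) / f 0\<close> is
  \<open>\<alpha>\<close> times the Wronskian divided by \<open>(f 0)\<^sup>2\<close>. Up to the
  factor \<open>lam 0 - lam (Suc k)\<close>, this quotient is therefore the flux that belongs to the
  Wronskian.\<close>

lemma sl_system_darboux:
  assumes sys: "sl_system r a b c \<alpha> \<beta> (Suc N) lam f q"
  shows "sl_system r a b c (\<lambda>x. \<beta> x * (f 0 x)\<^sup>2) (\<lambda>x. \<alpha> x / (f 0 x)\<^sup>2) N (\<lambda>k. lam (Suc k) - lam 0)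
     (darboux f q) (\<lambda>k x. (lam 0 - lam (Suc k)) * f (Suc k) x / f 0 x)"
proof -
  note f0 = sl_system_nonzero[OF sys]
  have cont: "continuous_on {a<..<b} (f k)" "continuous_on {a<..<b} (q k)" if "k < Suc N" for k
    using sys that unfolding sl_system_def by auto
  have der: "(f k has_real_derivative \<alpha> x * q k x) (at x)" if "k < Suc N" "x \<in> {a<..<b}" "x \<noteq> c" for k x
    using sys that unfolding sl_system_def by auto
  show ?thesis
    unfolding sl_system_def
  proof (intro conjI ballI allI impI)
    fix k x assume k: "k < N"
    show "continuous_on {a<..<b} (darboux f q k)"
      unfolding darboux_def[abs_def] using k by (intro continuous_intros cont) auto
    show "continuous_on {a<..<b} (\<lambda>x. (lam 0 - lam (Suc k)) * f (Suc k) x / f 0 x)"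
      using k f0 by (intro continuous_intros cont) auto
    assume "x \<in> {a<..<b} - {c}"
    then have x: "x \<in> {a<..<b}" "x \<noteq> c" by auto
    show "(darboux f q k has_real_derivative
         \<beta> x * (f 0 x)\<^sup>2 * ((lam 0 - lam (Suc k)) * f (Suc k) x / f 0 x)) (at x)"
      using darboux_deriv[OF sys k x] f0[OF x(1)] by (simp add: power2_eq_square mult_ac)
    have d: "(f (Suc k) has_real_derivative \<alpha> x * q (Suc k) x) (at x)" "(f 0 has_real_derivative \<alpha> x * q 0 x) (at x)"
      using der x k by auto
    show "((\<lambda>x. (lam 0 - lam (Suc k)) * f (Suc k) x / f 0 x) has_real_derivative
         - (lam (Suc k) - lam 0) * (\<alpha> x / (f 0 x)\<^sup>2) * darboux f q k x) (at x)"
      by (rule derivative_eq_intros d refl f0[OF x(1)])+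
        (use f0[OF x(1)] in \<open>simp add: darboux_def power2_eq_square field_simps\<close>)
  next
    show "inj_on (\<lambda>k. lam (Suc k) - lam 0) {..<N}"
      using sys unfolding sl_system_def inj_on_def by auto
  next
    show "end_regular (at_right a) N (darboux f q) (\<lambda>k x. (lam 0 - lam (Suc k)) * f (Suc k) x / f 0 x)"
      by (rule end_regular_darboux[OF sys]) (use sys in \<open>auto simp: sl_system_def\<close>)
    show "end_regular (at_left b) N (darboux f q) (\<lambda>k x. (lam 0 - lam (Suc k)) * f (Suc k) x / f 0 x)" if r
      by (rule end_regular_darboux[OF sys]) (use sys that in \<open>auto simp: sl_system_def\<close>)
  next
    fix k assume "k < N"
    then show "finite (zeros a b (darboux f q k))" "card (zeros a b (darboux f q k)) \<le> (if r then k else 0)"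
      using sl_darboux_zeros[OF sys] by auto
  next
    fix x assume x: "x \<in> {a<..<b}"
    then have "\<alpha> x > 0" "\<beta> x > 0" using sys unfolding sl_system_def by auto
    then show "0 < \<beta> x * (f 0 x)\<^sup>2" "0 < \<alpha> x / (f 0 x)\<^sup>2" using f0[OF x] by auto
  next
    show "a < c" "c < b" using sys unfolding sl_system_def by auto
  qed
qed

text \<open>Dividing by the ground state and differentiating removes \<open>C 0\<close> and leaves a
  positive weight times a combination of \<open>N - 1\<close> Wronskians, so Rolle's theorem and
  induction apply. The last clause counts \<open>b\<close> as one more zero; its premise says that
  the combination is small there compared with the ground state.\<close>

lemma sl_zero_count:
  assumes "sl_system r a b c \<alpha> \<beta> N lam f q" "\<exists>k<N. C k \<noteq> 0"
  shows "finite (zeros a b (\<lambda>x. \<Sum>k<N. C k * f k x)) \<and>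
         card (zeros a b (\<lambda>x. \<Sum>k<N. C k * f k x)) < N \<and>
         (((\<lambda>x. (\<Sum>k<N. C k * f k x) / f 0 x) \<longlongrightarrow> 0) (at_left b) \<longrightarrow>
           card (zeros a b (\<lambda>x. \<Sum>k<N. C k * f k x)) + 1 < N)"
  using assms
proof (induction N arbitrary: \<alpha> \<beta> lam f q C)
  case 0
  then show ?case by simp
next
  case (Suc N)
  note [simp del] = sum.lessThan_Suc
  note sys = Suc.prems(1)
  note f0 = sl_system_nonzero[OF sys]
  have ab: "a < b" using sys unfolding sl_system_def by linarith
  let ?S = "\<lambda>x. \<Sum>k<Suc N. C k * f k x"
  let ?g = "\<lambda>x. ?S x / f 0 x"
  have S: "?S x = C 0 * f 0 x + (\<Sum>k<N. C (Suc k) * f (Suc k) x)" for x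
    by (subst sum.lessThan_Suc_shift) simp
  show ?case
  \<comment> \<open>If only \<open>C 0\<close> is nonzero, the combination of Wronskians is trivial
    and the induction hypothesis says nothing; the quotient is then a nonzero constant.\<close>
  proof (cases "\<exists>k<N. C (Suc k) \<noteq> 0")
    case False
    then have S0: "?S x = C 0 * f 0 x" for x unfolding S using False by simp
    have C0: "C 0 \<noteq> 0" using Suc.prems(2) False by (metis Suc_less_eq not0_implies_Suc)
    have z: "zeros a b ?S = {}" using f0 C0 by (auto simp: zeros_def S0)
    have nl: "\<not> (?g \<longlongrightarrow> 0) (at_left b)"
    proof
      assume "(?g \<longlongrightarrow> 0) (at_left b)"
      moreover have "eventually (\<lambda>x. ?g x = C 0) (at_left b)"
        using eventually_at_left_real[OF ab] by eventually_elim (use S0 f0 in simp)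
      ultimately have "((\<lambda>x. C 0) \<longlongrightarrow> 0) (at_left b)"
        by (rule Lim_transform_eventually)
      then show False using C0 by (simp add: tendsto_const_iff)
    qed
    show ?thesis unfolding z using nl by simp
  next
    case True
    define W where "W x = (\<Sum>k<N. C (Suc k) * darboux f q k x)" for x
    have sys': "sl_system r a b c (\<lambda>x. \<beta> x * (f 0 x)\<^sup>2) (\<lambda>x. \<alpha> x / (f 0 x)\<^sup>2) N (\<lambda>k. lam (Suc k) - lam 0)
       (darboux f q) (\<lambda>k x. (lam 0 - lam (Suc k)) * f (Suc k) x / f 0 x)"
      by (rule sl_system_darboux[OF sys])
    have zW: "finite (zeros a b W)" "card (zeros a b W) < N"
      using Suc.IH[OF sys' True] unfolding W_def by auto
    have cont: "continuous_on {a<..<b} (f k)" if "k < Suc N" for k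
      using sys that unfolding sl_system_def by auto
    have contg: "continuous_on {a<..<b} ?g"
      using f0 by (intro continuous_intros cont) auto
    have contW: "continuous_on {a<..<b} W"
      unfolding W_def using sys' by (intro continuous_intros) (auto simp: sl_system_def)
    have der: "(?g has_real_derivative (\<alpha> x / (f 0 x)\<^sup>2) * W x) (at x)"
      if x: "x \<in> {a<..<b}" "x \<noteq> c" for x
    proof -
      have d: "(f k has_real_derivative \<alpha> x * q k x) (at x)" if "k < Suc N" for k
        using sys that x unfolding sl_system_def by auto
      have dS: "(?S has_real_derivative (\<Sum>k<Suc N. C k * (\<alpha> x * q k x))) (at x)"
        by (intro DERIV_sum DERIV_cmult d) auto
      have "(\<Sum>k<Suc N. C k * (\<alpha> x * q k x)) * f 0 x - ?S x * (\<alpha> x * q 0 x) = \<alpha> x * W x"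
        unfolding S W_def darboux_def sum.lessThan_Suc_shift[of "\<lambda>k. C k * (\<alpha> x * q k x)"]
        by (simp add: algebra_simps sum_distrib_left sum_distrib_right sum_subtractf)
      then show ?thesis
        using DERIV_divide[OF dS d[of 0] f0[OF x(1)]] by (simp add: power2_eq_square)
    qed
    have pos: "0 < \<alpha> x / (f 0 x)\<^sup>2" if "x \<in> {a<..<b}" for x
      using sys f0[OF that] that by (auto simp: sl_system_def)
    have interior: "finite (zeros a b ?S) \<and> card (zeros a b ?S) \<le> N"
    proof (rule finite_zerosI)
      fix Z assume Z: "finite Z" "Z \<subseteq> zeros a b ?S"
      have "card Z \<le> card (zeros a b W) + 1"
        by (rule rolle_count[where u = ?g and h = W and c = c and I = "{a<..<b}" and \<rho> = "\<lambda>x. \<alpha> x / (f 0 x)\<^sup>2"])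
          (use Z contg contW der pos zW in \<open>auto simp: zeros_def is_interval_1\<close>)
      then show "card Z \<le> N" using zW by simp
    qed
    moreover have "card (zeros a b ?S) + 1 < Suc N" if lim: "(?g \<longlongrightarrow> 0) (at_left b)"
    proof -
      \<comment> \<open>Extending the quotient by its limit 0 turns \<open>b\<close> into an
        additional zero for Rolle's theorem.\<close>
      define u where "u x = (if x = b then 0 else ?g x)" for x
      have u_near: "eventually (\<lambda>y. u y = ?g y) (nhds x)" if "x \<in> {a<..<b}" for x
        using eventually_nhds_in_open[OF open_greaterThanLessThan that]
        by eventually_elim (auto simp: u_def)
      let ?Z = "insert b (zeros a b ?S)"
      have "card ?Z \<le> card (zeros a b W) + 1"
      proof (rule rolle_count[where u = u and h = W and c = c and I = "{a<..b}" and \<rho> = "\<lambda>x. \<alpha> x / (f 0 x)\<^sup>2"])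
        show "continuous_on {a<..b} u"
          unfolding continuous_on_def
        proof
          fix x assume x: "x \<in> {a<..b}"
          show "(u \<longlongrightarrow> u x) (at x within {a<..b})"
          proof (cases "x = b")
            case True
            have "(u \<longlongrightarrow> 0) (at_left b)"
              by (rule Lim_transform_eventually[OF lim]) (auto simp: u_def eventually_at_filter)
            moreover have "at b within {a<..b} \<le> at_left b"
              unfolding at_within_def by (intro inf_mono) auto
            ultimately show ?thesis using True tendsto_mono[of "at b within {a<..b}" "at_left b"]
              by (simp add: u_def)
          next
            case False
            then have xi: "x \<in> {a<..<b}" using x by auto
            then have "(?g \<longlongrightarrow> ?g x) (at x)"
              using contg by (simp add: continuous_on_eq_continuous_at isCont_def)
            moreover have "eventually (\<lambda>y. ?g y = u y) (at x)"
              using u_near[OF xi] by (auto simp: eventually_nhds_conv_at eq_commute)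
            ultimately have "(u \<longlongrightarrow> ?g x) (at x)" by (rule Lim_transform_eventually)
            then show ?thesis using False by (simp add: u_def tendsto_within_subset[of _ _ _ UNIV])
          qed
        qed
        show "(u has_real_derivative \<alpha> t / (f 0 t)\<^sup>2 * W t) (at t)" if "t \<in> {a<..<b}" "t \<noteq> c" for t
          using der[OF that] DERIV_cong_ev[OF refl u_near[OF that(1)] refl] by simp
      qed (use interior contW pos zW ab in \<open>auto simp: zeros_def is_interval_1 u_def\<close>)
      moreover have "card ?Z = card (zeros a b ?S) + 1"
        using interior by (simp add: zeros_def)
      ultimately show ?thesis using zW by simp
    qed
    ultimately show ?thesis by simp
  qed
qed

section \<open>Eigenfunctions of a star\<close>

lemma oscillator_solution:
  fixes f d :: "real \<Rightarrow> real"
  assumes m: "m > 0"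
    and f: "\<And>x. x \<in> {0..a} \<Longrightarrow> (f has_real_derivative d x) (at x within {0..a})"
    and d: "\<And>x. x \<in> {0..a} \<Longrightarrow> (d has_real_derivative - (m\<^sup>2 * f x)) (at x within {0..a})"
    and x: "x \<in> {0..a}"
  shows "f x = f 0 * cos (m * x) + d 0 / m * sin (m * x)"
proof -
  \<comment> \<open>\<open>P\<close> and \<open>Q\<close> are the coordinates of the phase point (f,
    d/m) rotated back by the angle \<open>m * t\<close>, hence constant along a solution.\<close>
  define P where "P t = f t * cos (m * t) - d t / m * sin (m * t)" for t
  define Q where "Q t = f t * sin (m * t) + d t / m * cos (m * t)" for t
  have "(P has_real_derivative 0) (at t within {0..a})" if "t \<in> {0..a}" for t
    unfolding P_def[abs_def] using m
    by (auto intro!: derivative_eq_intros f[OF that] d[OF that] simp: field_simps power2_eq_square)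
  then obtain p where p: "\<And>t. t \<in> {0..a} \<Longrightarrow> P t = p"
    using has_field_derivative_zero_constant[of "{0..a}" P] by auto
  have "(Q has_real_derivative 0) (at t within {0..a})" if "t \<in> {0..a}" for t
    unfolding Q_def[abs_def] using m
    by (auto intro!: derivative_eq_intros f[OF that] d[OF that] simp: field_simps power2_eq_square)
  then obtain q where q: "\<And>t. t \<in> {0..a} \<Longrightarrow> Q t = q"
    using has_field_derivative_zero_constant[of "{0..a}" Q] by auto
  have z: "0 \<in> {0..a}" using x by auto
  have "P x = P 0" "Q x = Q 0" using p[OF x] p[OF z] q[OF x] q[OF z] by simp_all
  then have "P x = f 0" "Q x = d 0 / m" by (simp_all add: P_def[of 0] Q_def[of 0])
  moreover have "f x = P x * cos (m * x) + Q x * sin (m * x)"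
  proof -
    have "P x * cos (m * x) + Q x * sin (m * x) = f x * ((sin (m * x))\<^sup>2 + (cos (m * x))\<^sup>2)"
      unfolding P_def Q_def
      by (simp add: algebra_simps power2_eq_square del: sin_cos_squared_add sin_cos_squared_add2 sin_cos_squared_add3)
    then show ?thesis by simp
  qed
  ultimately show ?thesis by simp
qed

text \<open>The product \<open>f t * d t\<close> has derivative
  \<open>(d t)\<^sup>2 - lam * (f t)\<^sup>2 \<ge> 0\<close> and vanishes at \<open>a\<close>, so it
  is at most 0 at the centre. If it is 0 there, it is 0 throughout; then \<open>d\<close> vanishes
  in the interior and \<open>f\<close> is constant with value \<open>f a = 0\<close>.\<close>

lemma nonneg_energy_trivial:
  fixes f d :: "real \<Rightarrow> real"
  assumes a: "0 < a" and lam: "lam \<le> 0"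
    and f: "\<And>x. x \<in> {0..a} \<Longrightarrow> (f has_real_derivative d x) (at x within {0..a})"
    and d: "\<And>x. x \<in> {0..a} \<Longrightarrow> (d has_real_derivative - (lam * f x)) (at x within {0..a})"
    and end0: "f a = 0"
  shows "f 0 * d 0 \<le> 0" and "f 0 * d 0 = 0 \<Longrightarrow> x \<in> {0..a} \<Longrightarrow> f x = 0"
proof -
  let ?h = "\<lambda>t. f t * d t"
  have dh: "(?h has_real_derivative (d t)\<^sup>2 - lam * (f t)\<^sup>2) (at t within {0..a})" if "t \<in> {0..a}" for t
    by (rule derivative_eq_intros f[OF that] d[OF that] refl)+ (simp add: power2_eq_square)
  have at: "at t within {0..a} = at t" if "t \<in> {0<..<a}" for t
    using that by (intro at_within_interior) (auto simp: interior_atLeastAtMost_real)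
  have conth: "continuous_on {0..a} ?h" 
    by (rule DERIV_continuous_on) (rule dh)
  have contf: "continuous_on {0..a} f" 
    by (rule DERIV_continuous_on) (rule f)
  have mono: "?h u \<le> ?h v" if "0 \<le> u" "u \<le> v" "v \<le> a" for u v
  proof (rule DERIV_nonneg_imp_increasing_open[OF that(2)])
    fix t assume t: "u < t" "t < v"
    then have ti: "t \<in> {0<..<a}" using that by auto
    have "(d t)\<^sup>2 - lam * (f t)\<^sup>2 \<ge> 0" 
      using mult_nonpos_nonneg[OF lam zero_le_power2[of "f t"]] zero_le_power2[of "d t"] by linarith
    then show "\<exists>y. DERIV ?h t :> y \<and> 0 \<le> y" using dh[of t] ti at[OF ti] by auto
  next
    show "continuous_on {u..v} ?h"
      by (rule continuous_on_subset[OF conth]) (use that in auto)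
  qed
  show "f 0 * d 0 \<le> 0" using mono[of 0 a] a end0 by simp
  assume h0: "f 0 * d 0 = 0" and x: "x \<in> {0..a}"
  have hz: "?h t = 0" if "t \<in> {0..a}" for t
    using mono[of 0 t] mono[of t a] that h0 end0 by auto
  have dz: "d t = 0" if t: "t \<in> {0<..<a}" for t
  proof -
    have "(?h has_real_derivative (d t)\<^sup>2 - lam * (f t)\<^sup>2) (at t)" using dh[of t] at[OF t] t by auto
    moreover have "(?h has_real_derivative 0) (at t)"
      by (rule has_field_derivative_transform_within_open[where S = "{0<..<a}" and f = "\<lambda>_. 0"])
        (use t hz in auto)
    ultimately have e: "(d t)\<^sup>2 - lam * (f t)\<^sup>2 = 0" by (rule DERIV_unique)
    have "lam * (f t)\<^sup>2 \<le> 0" using mult_nonpos_nonneg[OF lam zero_le_power2] .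
    then have "(d t)\<^sup>2 \<le> 0" using e by linarith
    then show ?thesis by simp
  qed
  show "f x = 0"
  proof (cases "x = a")
    case False
    then have "x < a" using x by auto
    have "f a = f x"
    proof (rule DERIV_isconst_end[OF \<open>x < a\<close>])
      show "continuous_on {x..a} f" by (rule continuous_on_subset[OF contf]) (use x in auto)
      show "DERIV f t :> 0" if "x < t" "t < a" for t
        using f[of t] dz[of t] at[of t] that x by auto
    qed
    then show ?thesis using end0 by simp
  qed (use end0 in simp)
qed

text \<open>A mode with value 1 at the centre has outgoing derivative
  \<open>- m * cot (m * l j)\<close> on edge \<open>j\<close>, so a zero of this sum is the
  Kirchhoff condition.\<close>

definition secular :: "nat \<Rightarrow> (nat \<Rightarrow> real) \<Rightarrow> real \<Rightarrow> real" where
  "secular s l m = (\<Sum>j\<le>s. cot (m * l j))"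

definition star_mode :: "(nat \<Rightarrow> real) \<Rightarrow> real \<Rightarrow> nat \<Rightarrow> real \<Rightarrow> real" where
  "star_mode l m j x = sin (m * (l j - x)) / sin (m * l j)"

lemma eigenfunction_form:
  assumes l: "star_lengths s l" and eig: "is_eigenfunction s l lam f"
  obtains m d where "m > 0" "lam = m\<^sup>2" "(\<Sum>j\<le>s. d j) = 0"
    "\<And>j x. j \<le> s \<Longrightarrow> x \<in> {0..l j} \<Longrightarrow> f j x = f 0 0 * cos (m * x) + d j / m * sin (m * x)"
proof -
  have lp: "l j > 0" if "j \<le> s" for j using l that by (simp add: star_lengths_def)
  from eig obtain d dd where nz: "\<not> graph_eq s l f (\<lambda>_ _. 0)"
    and D: "\<And>j x. j \<le> s \<Longrightarrow> x \<in> {0..l j} \<Longrightarrow> (f j has_real_derivative d j x) (at x within {0..l j})"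
    "\<And>j x. j \<le> s \<Longrightarrow> x \<in> {0..l j} \<Longrightarrow> (d j has_real_derivative dd j x) (at x within {0..l j})"
    "\<And>j x. j \<le> s \<Longrightarrow> x \<in> {0..l j} \<Longrightarrow> - dd j x = lam * f j x"
    and kirch: "(\<Sum>j\<le>s. d j 0) = 0" and bd: "\<And>j. j \<le> s \<Longrightarrow> f j (l j) = 0"
    and c: "\<And>j. j \<le> s \<Longrightarrow> f j 0 = f 0 0"
    unfolding is_eigenfunction_def by blast
  have dd: "dd j x = - (lam * f j x)" if "j \<le> s" "x \<in> {0..l j}" for j x
    using D(3)[OF that] by simp
  have D2: "(d j has_real_derivative - (lam * f j x)) (at x within {0..l j})" if "j \<le> s" "x \<in> {0..l j}" for j x
    using D(2)[OF that] dd[OF that] by simp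
  \<comment> \<open>With a common centre value, Kirchhoff's condition makes the products
    \<open>f j 0 * d j 0\<close> sum to 0. For \<open>lam \<le> 0\<close> none of them is positive,
    so all vanish and the function is trivial.\<close>
  have "lam > 0"
  proof (rule ccontr)
    assume "\<not> lam > 0"
    then have "lam \<le> 0" by simp
    note E = nonneg_energy_trivial[OF lp this D(1) D2 bd]
    have le: "f j 0 * d j 0 \<le> 0" if "j \<le> s" for j by (rule E(1)) (use that in auto)
    have "(\<Sum>j\<le>s. f j 0 * d j 0) = (\<Sum>j\<le>s. f 0 0 * d j 0)"
      by (intro sum.cong refl arg_cong2[where f = "(*)"] c) auto
    then have "(\<Sum>j\<le>s. - (f j 0 * d j 0)) = 0"
      using kirch by (simp add: sum_negf flip: sum_distrib_left)
    then have "\<forall>j\<in>{..s}. - (f j 0 * d j 0) = 0"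
      by (rule sum_nonneg_eq_0_iff[THEN iffD1, rotated 2]) (use le in auto)
    then have z: "f j 0 * d j 0 = 0" if "j \<le> s" for j using that by simp
    have "f j x = 0" if "j \<le> s" "x \<in> {0..l j}" for j x
      by (rule E(2)) (use that z in auto)
    then show False using nz by (auto simp: graph_eq_def)
  qed
  define m where "m = sqrt lam"
  have m: "m > 0" "lam = m\<^sup>2" using \<open>lam > 0\<close> by (auto simp: m_def)
  show thesis
  proof (rule that[OF m kirch])
    fix j x assume j: "j \<le> s" "x \<in> {0..l j}"
    have "f j x = f j 0 * cos (m * x) + d j 0 / m * sin (m * x)"
      by (rule oscillator_solution[OF m(1) D(1) _ j(2)]) (use j D2 m in auto)
    then show "f j x = f 0 0 * cos (m * x) + d j 0 / m * sin (m * x)" using c[OF j(1)] by simp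
  qed
qed

definition incommensurable :: "nat \<Rightarrow> (nat \<Rightarrow> real) \<Rightarrow> bool" where
  "incommensurable s l \<longleftrightarrow> (\<forall>i\<le>s. \<forall>j\<le>s. i \<noteq> j \<longrightarrow> l i / l j \<notin> \<rat>)"

lemma common_zero_rational:
  fixes x y m :: real
  assumes "sin (m * x) = 0" "sin (m * y) = 0" "m > 0"
  shows "x / y \<in> \<rat>"
proof -
  obtain i j :: int where ij: "m * x = of_int i * pi" "m * y = of_int j * pi"
    using assms sin_zero_iff_int2 by metis
  have "x / y = (m * x) / (m * y)" using assms(3) by simp
  also have "\<dots> = of_int i / of_int j" unfolding ij by simp
  also have "\<dots> \<in> \<rat>" by simp
  finally show ?thesis .
qed

text \<open>A function vanishing at the centre is a pure sine on each edge. The slopes sum to 0 and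
  are not all 0, so at least two edges carry sines of the same frequency with zeros at both ends,
  which makes the ratio of their lengths rational.\<close>

lemma eigenfunction_nonzero_centre:
  assumes l: "star_lengths s l" and inc: "incommensurable s l" and eig: "is_eigenfunction s l lam f"
  shows "f 0 0 \<noteq> 0"
proof
  assume f0: "f 0 0 = 0"
  obtain m d where m: "m > 0" "lam = m\<^sup>2" and d: "(\<Sum>j\<le>s. d j) = 0"
    and F: "\<And>j x. j \<le> s \<Longrightarrow> x \<in> {0..l j} \<Longrightarrow> f j x = f 0 0 * cos (m * x) + d j / m * sin (m * x)"
    using eigenfunction_form[OF l eig] by blast
  have z: "d j * sin (m * l j) = 0" if "j \<le> s" for j
  proof -
    have "f j (l j) = 0" using eig that by (auto simp: is_eigenfunction_def)
    moreover have "l j \<in> {0..l j}" using l that by (auto simp: star_lengths_def less_imp_le)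
    ultimately show ?thesis using F[OF that, of "l j"] f0 m by simp
  qed
  have "\<exists>i\<le>s. d i \<noteq> 0"
  proof (rule ccontr)
    assume "\<not> ?thesis"
    then have "graph_eq s l f (\<lambda>_ _. 0)" using F f0 by (auto simp: graph_eq_def)
    then show False using eig by (auto simp: is_eigenfunction_def)
  qed
  then obtain i where i: "i \<le> s" "d i \<noteq> 0" by blast
  have "\<exists>j\<le>s. j \<noteq> i \<and> d j \<noteq> 0"
  proof (rule ccontr)
    assume "\<not> ?thesis"
    then have "(\<Sum>j\<in>{..s} - {i}. d j) = 0" by (intro sum.neutral) auto
    then show False using d i sum.remove[of "{..s}" i d] by auto
  qed
  then obtain j where j: "j \<le> s" "j \<noteq> i" "d j \<noteq> 0" by blast
  have "l i / l j \<in> \<rat>"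
    by (rule common_zero_rational[of m]) (use z i j m in auto)
  then show False using inc i j by (auto simp: incommensurable_def)
qed

text \<open>As the centre value is nonzero, \<open>sin (m * l j) = 0\<close> would force the cosine
  to vanish too. The Dirichlet condition then fixes every slope, so up to a scalar the eigenfunction
  is determined by its frequency: eigenvalues are simple.\<close>

lemma eigenfunction_mode:
  assumes l: "star_lengths s l" and inc: "incommensurable s l" and eig: "is_eigenfunction s l lam f"
  obtains m where "m > 0" "lam = m\<^sup>2" "\<And>j. j \<le> s \<Longrightarrow> sin (m * l j) \<noteq> 0" "secular s l m = 0"
    "\<And>j x. j \<le> s \<Longrightarrow> x \<in> {0..l j} \<Longrightarrow> f j x = f 0 0 * star_mode l m j x"
proof -
  obtain m d where m: "m > 0" "lam = m\<^sup>2" and d: "(\<Sum>j\<le>s. d j) = 0"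
    and F: "\<And>j x. j \<le> s \<Longrightarrow> x \<in> {0..l j} \<Longrightarrow> f j x = f 0 0 * cos (m * x) + d j / m * sin (m * x)"
    using eigenfunction_form[OF l eig] by blast
  have f0: "f 0 0 \<noteq> 0" by (rule eigenfunction_nonzero_centre[OF l inc eig])
  have z: "f 0 0 * cos (m * l j) + d j / m * sin (m * l j) = 0" if "j \<le> s" for j
  proof -
    have "f j (l j) = 0" using eig that by (auto simp: is_eigenfunction_def)
    moreover have "l j \<in> {0..l j}" using l that by (auto simp: star_lengths_def less_imp_le)
    ultimately show ?thesis using F[OF that, of "l j"] by simp
  qed
  have nz: "sin (m * l j) \<noteq> 0" if "j \<le> s" for j
  proof
    assume s0: "sin (m * l j) = 0"
    then have "cos (m * l j) \<noteq> 0" using sin_cos_squared_add[of "m * l j"] by auto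
    then show False using z[OF that] s0 f0 by simp
  qed
  have dj: "d j = - (m * f 0 0) * cot (m * l j)" if "j \<le> s" for j
    using z[OF that] nz[OF that] m(1) by (simp add: cot_def field_simps)
  have "(\<Sum>j\<le>s. d j) = - (m * f 0 0) * secular s l m"
    unfolding secular_def sum_distrib_left using dj by (intro sum.cong) auto
  then have sec: "secular s l m = 0" using d f0 m by simp
  show thesis
  proof (rule that[OF m nz sec])
    fix j x assume j: "j \<le> s" "x \<in> {0..l j}"
    show "f j x = f 0 0 * star_mode l m j x"
      unfolding F[OF j] dj[OF j(1)] star_mode_def right_diff_distrib sin_diff
      using nz[OF j(1)] m(1) by (simp add: cot_def field_simps)
  qed
qed

lemma star_mode_eigenfunction:
  assumes l: "star_lengths s l" and m: "m > 0"
    and nz: "\<And>j. j \<le> s \<Longrightarrow> sin (m * l j) \<noteq> 0" and sec: "secular s l m = 0"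
  shows "is_eigenfunction s l (m\<^sup>2) (star_mode l m)"
  unfolding is_eigenfunction_def
proof (intro conjI)
  have one: "star_mode l m j 0 = 1" if "j \<le> s" for j using nz[OF that] by (simp add: star_mode_def)
  have "l 0 > 0" using l by (simp add: star_lengths_def)
  then show "\<not> graph_eq s l (star_mode l m) (\<lambda>_ _. 0)"
    using one[of 0] unfolding graph_eq_def by (auto intro!: exI[of _ 0] bexI[of _ 0])
  show "\<forall>j\<le>s. star_mode l m j (l j) = 0" by (simp add: star_mode_def)
  show "\<forall>j\<le>s. star_mode l m j 0 = star_mode l m 0 0" using one by simp
  let ?d = "\<lambda>j x. - m * cos (m * (l j - x)) / sin (m * l j)"
  show "\<exists>d dd. (\<forall>j\<le>s. \<forall>x\<in>{0..l j}.
            (star_mode l m j has_real_derivative d j x) (at x within {0..l j}) \<and>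
            (d j has_real_derivative dd j x) (at x within {0..l j}) \<and>
            - dd j x = m\<^sup>2 * star_mode l m j x) \<and> (\<Sum>j\<le>s. d j 0) = 0"
  proof (rule exI[of _ ?d], rule exI[of _ "\<lambda>j x. - m\<^sup>2 * star_mode l m j x"], intro conjI allI impI ballI)
    fix j x assume j: "j \<le> s" "x \<in> {0..l j}"
    show "(star_mode l m j has_real_derivative ?d j x) (at x within {0..l j})"
      unfolding star_mode_def[abs_def]
      by (rule derivative_eq_intros nz[OF j(1)] refl)+ (use nz[OF j(1)] in \<open>simp add: field_simps\<close>)
    show "(?d j has_real_derivative - m\<^sup>2 * star_mode l m j x) (at x within {0..l j})"
      unfolding star_mode_def[abs_def]
      by (rule derivative_eq_intros nz[OF j(1)] refl)+
        (use nz[OF j(1)] in \<open>simp add: field_simps power2_eq_square\<close>)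
  next
    have "(\<Sum>j\<le>s. ?d j 0) = - m * secular s l m"
      unfolding secular_def sum_distrib_left by (intro sum.cong) (auto simp: cot_def)
    then show "(\<Sum>j\<le>s. ?d j 0) = 0" using sec by simp
  qed simp
qed

lemma zero_generic_incommensurable:
  assumes "star_lengths s l" "incommensurable s l"
  shows "zero_generic s l"
  unfolding zero_generic_def using eigenfunction_nonzero_centre[OF assms] by blast

section \<open>Orthogonality and the order of the eigenvalues\<close>

lemma star_mode_inner_pos:
  assumes l: "star_lengths s l" and nz: "sin (m * l 0) \<noteq> 0"
  shows "graph_inner s l (star_mode l m) (star_mode l m) > 0"
proof -
  have lp: "l j > 0" if "j \<le> s" for j using l that by (simp add: star_lengths_def)
  let ?h = "\<lambda>j x. star_mode l m j x * star_mode l m j x"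
  have cont: "continuous_on S (?h j)" for S j
    unfolding star_mode_def[abs_def] divide_inverse by (intro continuous_intros)
  have nonneg: "integral {0..l j} (?h j) \<ge> 0" for j
    by (intro integral_nonneg integrable_continuous_real cont) auto
  have "integral {0..l 0} (?h 0) \<noteq> 0"
  proof
    assume "integral {0..l 0} (?h 0) = 0"
    then have "\<forall>x\<in>{0..l 0}. ?h 0 x = 0"
      using integral_eq_0_iff[OF cont, of 0 "l 0" 0] lp[of 0] by auto
    then have "?h 0 0 = 0" using lp[of 0] by (auto simp: less_imp_le)
    then show False using nz by (simp add: star_mode_def)
  qed
  then have "integral {0..l 0} (?h 0) > 0" using nonneg[of 0] by linarith
  then show ?thesis unfolding graph_inner_def
    by (intro sum_pos2[where i = 0] nonneg) auto
qed

lemma graph_inner_scaled: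
  assumes "\<And>j x. j \<le> s \<Longrightarrow> x \<in> {0..l j} \<Longrightarrow> f j x = A * h j x"
    and "\<And>j x. j \<le> s \<Longrightarrow> x \<in> {0..l j} \<Longrightarrow> g j x = B * h j x"
  shows "graph_inner s l f g = A * B * graph_inner s l h h"
proof -
  have "integral {0..l j} (\<lambda>x. f j x * g j x) = A * B * integral {0..l j} (\<lambda>x. h j x * h j x)"
    if "j \<le> s" for j
  proof -
    have "integral {0..l j} (\<lambda>x. f j x * g j x) = integral {0..l j} (\<lambda>x. A * B * (h j x * h j x))"
      by (rule integral_cong) (use assms that in simp)
    then show ?thesis by simp
  qed
  then show ?thesis unfolding graph_inner_def by (simp add: sum_distrib_left)
qed

text \<open>By induction the earlier positions are taken by smaller values, so \<open>m k\<close>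
  occurs at position \<open>k\<close> or later and \<open>Lam k \<le> m k < B\<close>. Hence
  \<open>Lam k\<close> is some \<open>m i\<close>; injectivity excludes \<open>i < k\<close> and the
  inequality excludes \<open>i > k\<close>.\<close>

lemma enumeration_eqI:
  fixes Lam m :: "nat \<Rightarrow> real"
  assumes Lam: "mono Lam" "inj Lam" and m: "\<And>i j. i < j \<Longrightarrow> j < N \<Longrightarrow> m i < m j"
    and mB: "\<And>k. k < N \<Longrightarrow> m k < B" and in_range: "\<And>k. k < N \<Longrightarrow> m k \<in> range Lam"
    and low: "\<And>k. Lam k < B \<Longrightarrow> \<exists>i<N. Lam k = m i"
  shows "k < N \<Longrightarrow> Lam k = m k"
proof (induction k rule: less_induct)
  case (less k)
  obtain n where n: "m k = Lam n" using in_range[OF less.prems] by auto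
  have "k \<le> n"
  proof (rule ccontr)
    assume "\<not> k \<le> n"
    then have "n < k" by simp
    then have "Lam n = m n" "m n < m k" using less m by auto
    then show False using n by simp
  qed
  then have le: "Lam k \<le> m k" using n Lam(1) by (simp add: monoD)
  then obtain i where i: "i < N" "Lam k = m i" using low[of k] mB[OF less.prems] by auto
  have "i = k"
  proof (rule linorder_cases[of i k])
    assume "i < k"
    then have "Lam i = Lam k" using less i by auto
    then show ?thesis using Lam(2) by (simp add: inj_eq)
  next
    assume "k < i"
    then have "m k < m i" using m i by auto
    then show ?thesis using le i by simp
  qed
  then show ?case using i by simp
qed

section \<open>The low spectrum of a star with short edges\<close>

text \<open>The bound \<open>lshort\<close> keeps \<open>m * l j\<close> below pi for all
  \<open>m\<close> up to \<open>pi * M\<close>. For positive \<open>m\<close> in that range the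
  short cotangents have no pole, and the poles of \<open>secular s l\<close> come from the long edge
  alone, at multiples of pi.\<close>

locale short_star =
  fixes s M :: nat and l :: "nat \<Rightarrow> real"
  assumes s: "0 < s" and l0: "l 0 = 1"
    and lpos: "\<And>j. 1 \<le> j \<Longrightarrow> j \<le> s \<Longrightarrow> 0 < l j"
    and lshort: "\<And>j. 1 \<le> j \<Longrightarrow> j \<le> s \<Longrightarrow> l j * real M < 1"
begin

lemma lengths: "star_lengths s l"
  unfolding star_lengths_def using l0 lpos by (metis One_nat_def Suc_leI gr0I zero_less_one)

lemma short_arg:
  assumes "1 \<le> j" "j \<le> s" "0 < m" "m \<le> pi * real M"
  shows "0 < m * l j" "m * l j < pi"
proof -
  show "0 < m * l j" using assms lpos by simp
  have "m * l j \<le> pi * real M * l j" using assms lpos[of j] by (intro mult_right_mono) auto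
  also have "\<dots> = pi * (l j * real M)" by simp
  also have "\<dots> < pi * 1" using lshort[of j] assms by (intro mult_strict_left_mono) auto
  finally show "m * l j < pi" by simp
qed

lemma sin_short_pos:
  assumes "1 \<le> j" "j \<le> s" "0 < m" "m \<le> pi * real M"
  shows "sin (m * l j) > 0"
  using short_arg[OF assms] by (simp add: sin_gt_zero)

definition band :: "nat \<Rightarrow> real set" where "band k = {pi * real k<..<pi * real (Suc k)}"

lemma band_bounds:
  assumes "k < M" "m \<in> band k"
  shows "0 < m" "m < pi * real M"
proof -
  have "0 \<le> pi * real k" by simp
  also have "\<dots> < m" using assms by (simp add: band_def)
  finally show "0 < m" .
  have "pi * real (Suc k) \<le> pi * real M" using assms by (intro mult_left_mono) auto
  moreover have "m < pi * real (Suc k)" using assms unfolding band_def by auto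
  ultimately show "m < pi * real M" by linarith
qed

lemma sin_band_nonzero:
  assumes "m \<in> band k"
  shows "sin m \<noteq> 0"
proof
  assume "sin m = 0"
  then obtain i :: int where i: "m = of_int i * pi" using sin_zero_iff_int2 by metis
  have "pi * real k < pi * of_int i" "pi * of_int i < pi * real (Suc k)"
    using assms i by (auto simp: band_def mult.commute)
  then have "of_int (int k) < (of_int i :: real)" "(of_int i :: real) < of_int (int (Suc k))"
    by simp_all
  then have "int k < i" "i < int (Suc k)" by (simp_all only: of_int_less_iff)
  then show False by linarith
qed

lemma sin_nonzero:
  assumes "k < M" "m \<in> band k" "j \<le> s"
  shows "sin (m * l j) \<noteq> 0"
proof (cases "j = 0")
  case True
  then show ?thesis using sin_band_nonzero[OF assms(2)] l0 by simp
next
  case False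
  then show ?thesis using sin_short_pos[of j m] band_bounds[OF assms(1,2)] assms(3) by simp
qed

lemma secular_strict_decreasing:
  assumes k: "k < M" and m: "m \<in> band k" and n: "n \<in> band k" and lt: "m < n"
  shows "secular s l n < secular s l m"
proof -
  have der: "(secular s l has_real_derivative (\<Sum>j\<le>s. - inverse ((sin (t * l j))\<^sup>2) * l j)) (at t)"
    (is "(_ has_real_derivative ?D t) _") if t: "t \<in> band k" for t
    unfolding secular_def[abs_def]
  proof (rule DERIV_sum)
    fix j assume "j \<in> {..s}"
    then have "sin (t * l j) \<noteq> 0" using sin_nonzero[OF k t] by simp
    moreover have "((\<lambda>m. m * l j) has_real_derivative l j) (at t)"
      by (auto intro!: derivative_eq_intros)
    ultimately show "((\<lambda>m. cot (m * l j)) has_real_derivative - inverse ((sin (t * l j))\<^sup>2) * l j) (at t)"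
      by (intro DERIV_chain2[where f = cot and g = "\<lambda>m. m * l j"] DERIV_cot)
  qed
  have neg: "?D t < 0" if t: "t \<in> band k" for t
  proof -
    have "(\<Sum>j\<le>s. inverse ((sin (t * l j))\<^sup>2) * l j) > 0"
      using lengths sin_nonzero[OF k t] by (intro sum_pos) (auto simp: star_lengths_def)
    then show ?thesis by (simp add: sum_negf)
  qed
  show ?thesis
  proof (rule DERIV_neg_imp_decreasing[OF lt])
    fix t assume "m \<le> t" "t \<le> n"
    then have "t \<in> band k" using m n by (auto simp: band_def)
    then show "\<exists>y. (secular s l has_real_derivative y) (at t) \<and> y < 0" using der neg by blast
  qed
qed

lemma ex_secular_root:
  assumes k: "k < M"
  shows "\<exists>m\<in>band k. secular s l m = 0"
proof -
  define R where "R m = (\<Sum>j\<in>{1..s}. cot (m * l j))" for m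
  \<comment> \<open>Multiplying the secular function by \<open>sin m\<close> removes the poles at
    the ends of the band, so the intermediate value theorem can start and stop there.\<close>
  define P where "P m = cos m + sin m * R m" for m
  have sec: "secular s l m = cot m + R m" for m
  proof -
    have "{..s} = insert 0 {1..s}" by auto
    then show ?thesis unfolding secular_def R_def by (simp add: l0)
  qed
  \<comment> \<open>The short cotangents have a pole at 0, so the lowest band is entered at pi/2,
    where \<open>cos\<close> vanishes and all short cotangents are positive.\<close>
  define lo where "lo = (if k = 0 then pi / 2 else pi * real k)"
  define hi where "hi = pi * real (Suc k)"
  have hiM: "hi \<le> pi * real M" unfolding hi_def using k by (intro mult_left_mono) auto
  have lohi: "0 < lo" "lo < hi" "pi * real k \<le> lo" by (auto simp: lo_def hi_def)
  have contP: "continuous_on {lo..hi} P"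
    unfolding P_def R_def
  proof (intro continuous_intros ballI)
    fix j x assume "j \<in> {1..s}" "x \<in> {lo..hi}"
    then have "sin (x * l j) > 0" using lohi hiM by (intro sin_short_pos) auto
    then show "sin (x * l j) \<noteq> 0" by simp
  qed
  have sgn_hi: "P hi * (-1) ^ k < 0"
    unfolding P_def hi_def by (simp add: mult.commute[of pi] cos_npi sin_npi del: of_nat_Suc)
  have sgn_lo: "P lo * (-1) ^ k > 0"
  proof (cases "k = 0")
    case True
    have "R (pi / 2) > 0"
      unfolding R_def
    proof (rule sum_pos)
      fix j assume j: "j \<in> {1..s}"
      have "M \<ge> 1" using k by simp
      then have "pi * 1 \<le> pi * real M" by (intro mult_left_mono) auto
      then have "pi / 2 \<le> pi * real M" using pi_gt_zero by linarith
      then have "0 < pi / 2 * l j" using short_arg(1)[of j "pi / 2"] j by simp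
      moreover have "l j < 1"
      proof -
        have "l j * 1 \<le> l j * real M"
          using lpos[of j] j \<open>M \<ge> 1\<close> by (intro mult_left_mono) auto
        also have "\<dots> < 1" using lshort[of j] j by simp
        finally show ?thesis by simp
      qed
      then have "pi / 2 * l j < pi / 2" using mult_strict_left_mono[of "l j" 1 "pi / 2"] by simp
      ultimately show "0 < cot (pi / 2 * l j)" by (intro cot_gt_zero) auto
    qed (use s in auto)
    then show ?thesis using True by (simp add: P_def lo_def)
  next
    case False
    then show ?thesis unfolding P_def lo_def
      by (simp add: mult.commute[of pi] cos_npi sin_npi)
  qed
  have "\<exists>m\<ge>lo. m \<le> hi \<and> P m * (-1) ^ k = 0"
    by (rule IVT2') (use sgn_lo sgn_hi lohi in \<open>auto intro!: continuous_intros contP\<close>)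
  then obtain m where m: "lo \<le> m" "m \<le> hi" "P m = 0" by auto
  have "m \<noteq> lo" "m \<noteq> hi" using m(3) sgn_lo sgn_hi by auto
  then have mb: "m \<in> band k" using m lohi by (auto simp: band_def hi_def)
  have "secular s l m = P m / sin m"
    using sin_band_nonzero[OF mb] by (simp add: sec P_def cot_def field_simps)
  then show ?thesis using mb m by auto
qed

text \<open>Taken from the secular equation rather than from a list of eigenvalues, so that it also
  applies to the equal-length star, where the list may contain modes that vanish at the
  centre.\<close>

definition freq :: "nat \<Rightarrow> real" where
  "freq k = (SOME m. m \<in> band k \<and> secular s l m = 0)"

lemma freq:
  assumes "k < M"
  shows "freq k \<in> band k" "secular s l (freq k) = 0"
proof -
  have "freq k \<in> band k \<and> secular s l (freq k) = 0"
    unfolding freq_def by (rule someI_ex) (use ex_secular_root[OF assms] in blast)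
  then show "freq k \<in> band k" "secular s l (freq k) = 0" by auto
qed

lemma freq_unique:
  assumes "k < M" "m \<in> band k" "secular s l m = 0"
  shows "m = freq k"
  using secular_strict_decreasing[OF assms(1), of m "freq k"]
    secular_strict_decreasing[OF assms(1), of "freq k" m] freq[OF assms(1)] assms
  by (metis less_irrefl linorder_neqE)

lemma freq_bounds:
  assumes "k < M"
  shows "0 < freq k" "freq k < pi * real M"
  using band_bounds[OF assms freq(1)[OF assms]] by auto

lemma freq_strict_mono:
  assumes "i < k" "k < M"
  shows "freq i < freq k"
proof -
  have "freq i < pi * real (Suc i)" using freq(1)[of i] assms by (auto simp: band_def)
  also have "\<dots> \<le> pi * real k" using assms by (intro mult_left_mono) auto
  also have "\<dots> < freq k" using freq(1)[of k] assms by (auto simp: band_def)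
  finally show ?thesis .
qed

text \<open>Division by zero gives \<open>cot\<close> the value 0 at its poles. The assumption on
  \<open>sin (m * l 0)\<close> keeps such spurious roots at multiples of pi away.\<close>

lemma secular_root_is_freq:
  assumes m: "0 < m" "m < pi * real M" and nz: "sin (m * l 0) \<noteq> 0" and root: "secular s l m = 0"
  shows "\<exists>k<M. m = freq k"
proof -
  define k where "k = nat \<lfloor>m / pi\<rfloor>"
  have q: "0 \<le> m / pi" using m by simp
  then have k: "real k \<le> m / pi" "m / pi < real k + 1" by (auto simp: k_def)
  have "pi * real k \<noteq> m"
  proof
    assume "pi * real k = m"
    then have "sin m = 0" using sin_npi[of k] by (simp add: mult.commute)
    then show False using nz l0 by simp
  qed
  moreover have "pi * real k \<le> m" "m < pi * real (Suc k)"
    using k by (simp_all add: field_simps)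
  ultimately have mb: "m \<in> band k" by (auto simp: band_def)
  have "pi * real k < pi * real M" using \<open>pi * real k \<le> m\<close> m by linarith
  then have "k < M" by simp
  then show ?thesis using freq_unique[OF _ mb root] by auto
qed

text \<open>This ties an arbitrary enumeration to the explicit modes. \<open>Lam\<close> is
  injective, since two eigenfunctions with one eigenvalue would be nonzero multiples of the same
  mode and could not be orthogonal.\<close>

lemma enumeration_low:
  assumes inc: "incommensurable s l" and enum: "eigen_enumeration s l Lam F" and k: "k < M"
  obtains A where "A \<noteq> 0" "\<And>j x. j \<le> s \<Longrightarrow> x \<in> {0..l j} \<Longrightarrow> F k j x = A * star_mode l (freq k) j x"
proof -
  note mode = eigenfunction_mode[OF lengths inc]
  have eig: "is_eigenfunction s l (Lam k) (F k)" for k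
    using enum by (simp add: eigen_enumeration_def)
  have c0: "F k 0 0 \<noteq> 0" for k by (rule eigenfunction_nonzero_centre[OF lengths inc eig])
  have inj: "inj Lam"
  proof (rule injI, rule ccontr)
    fix a b assume ab: "Lam a = Lam b" "a \<noteq> b"
    obtain m where m: "m > 0" "Lam a = m\<^sup>2" "\<And>j. j \<le> s \<Longrightarrow> sin (m * l j) \<noteq> 0" "secular s l m = 0"
      "\<And>j x. j \<le> s \<Longrightarrow> x \<in> {0..l j} \<Longrightarrow> F a j x = F a 0 0 * star_mode l m j x"
      by (rule mode[OF eig[of a]]) (rule that)
    obtain n where n: "n > 0" "Lam b = n\<^sup>2" "\<And>j. j \<le> s \<Longrightarrow> sin (n * l j) \<noteq> 0" "secular s l n = 0"
      "\<And>j x. j \<le> s \<Longrightarrow> x \<in> {0..l j} \<Longrightarrow> F b j x = F b 0 0 * star_mode l n j x"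
      by (rule mode[OF eig[of b]]) (rule that)
    have "n = m" using m n ab by (metis less_imp_le power2_eq_imp_eq)
    then have "graph_inner s l (F a) (F b) = F a 0 0 * F b 0 0 * graph_inner s l (star_mode l m) (star_mode l m)"
      using m(5) n(5) by (intro graph_inner_scaled) auto
    moreover have "graph_inner s l (F a) (F b) = 0"
      using enum ab by (auto simp: eigen_enumeration_def)
    ultimately show False
      using c0 star_mode_inner_pos[OF lengths m(3)[of 0]] by auto
  qed
  have Lam: "Lam k = (freq k)\<^sup>2"
  proof (rule enumeration_eqI[where N = M and B = "(pi * real M)\<^sup>2" and m = "\<lambda>k. (freq k)\<^sup>2", OF _ inj _ _ _ _ k])
    show "mono Lam" using enum by (simp add: eigen_enumeration_def)
    show "(freq i)\<^sup>2 < (freq j)\<^sup>2" if "i < j" "j < M" for i j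
      using freq_strict_mono[OF that] freq_bounds[of i] that by (intro power_strict_mono) auto
    show "(freq k)\<^sup>2 < (pi * real M)\<^sup>2" if "k < M" for k
      using freq_bounds[OF that] by (intro power_strict_mono) auto
    show "(freq k)\<^sup>2 \<in> range Lam" if "k < M" for k
    proof -
      have e: "is_eigenfunction s l ((freq k)\<^sup>2) (star_mode l (freq k))"
        by (rule star_mode_eigenfunction[OF lengths freq_bounds(1)[OF that] _ freq(2)[OF that]])
          (use sin_nonzero[OF that freq(1)[OF that]] in auto)
      then obtain K c where K: "\<forall>i\<in>K. Lam i = (freq k)\<^sup>2"
        "graph_eq s l (star_mode l (freq k)) (\<lambda>j x. \<Sum>i\<in>K. c i * F i j x)"
        using enum unfolding eigen_enumeration_def by blast
      \<comment> \<open>Completeness of the enumeration is used here: a nonzero mode needs at least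
        one term in its expansion, so its eigenvalue is listed.\<close>
      have "K \<noteq> {}"
      proof
        assume "K = {}"
        then have "graph_eq s l (star_mode l (freq k)) (\<lambda>_ _. 0)" using K(2) by simp
        then show False using e by (simp add: is_eigenfunction_def)
      qed
      then obtain i where "i \<in> K" by blast
      then show ?thesis using K(1) by (metis rangeI)
    qed
    show "\<exists>i<M. Lam k = (freq i)\<^sup>2" if lt: "Lam k < (pi * real M)\<^sup>2" for k
    proof -
      obtain m where m: "m > 0" "Lam k = m\<^sup>2" "\<And>j. j \<le> s \<Longrightarrow> sin (m * l j) \<noteq> 0" "secular s l m = 0"
        "\<And>j x. j \<le> s \<Longrightarrow> x \<in> {0..l j} \<Longrightarrow> F k j x = F k 0 0 * star_mode l m j x"
        by (rule mode[OF eig[of k]]) (rule that)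
      have "m < pi * real M" using lt m by (intro power_less_imp_less_base[of m 2]) auto
      then obtain i where "i < M" "m = freq i" using secular_root_is_freq[of m] m by auto
      then show ?thesis using m by auto
    qed
  qed
  obtain m where m: "m > 0" "Lam k = m\<^sup>2" "\<And>j. j \<le> s \<Longrightarrow> sin (m * l j) \<noteq> 0" "secular s l m = 0"
    "\<And>j x. j \<le> s \<Longrightarrow> x \<in> {0..l j} \<Longrightarrow> F k j x = F k 0 0 * star_mode l m j x"
    by (rule mode[OF eig[of k]]) (rule that)
  have "m = freq k" using m Lam freq_bounds(1)[OF k] by (metis less_imp_le power2_eq_imp_eq)
  then show thesis using that[OF c0[of k]] m(5) by blast
qed

end

section \<open>Zero counts on the star\<close>

lemma tendsto_sin_ratio:
  fixes m n :: real
  assumes "n \<noteq> 0"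
  shows "((\<lambda>t. sin (m * t) / sin (n * t)) \<longlongrightarrow> m / n) (at 0)"
proof -
  have d: "((\<lambda>t. sin (a * t) / t) \<longlongrightarrow> a) (at 0)" for a :: real
  proof -
    have "((\<lambda>t. sin (a * t)) has_real_derivative a) (at 0)"
      by (auto intro!: derivative_eq_intros)
    then show ?thesis by (simp add: has_field_derivative_iff)
  qed
  have "((\<lambda>t. (sin (m * t) / t) / (sin (n * t) / t)) \<longlongrightarrow> m / n) (at 0)"
    by (intro tendsto_divide d assms)
  moreover have "eventually (\<lambda>t. (sin (m * t) / t) / (sin (n * t) / t) = sin (m * t) / sin (n * t)) (at (0::real))"
    by (auto simp: eventually_at_filter)
  ultimately show ?thesis by (rule Lim_transform_eventually)
qed

text \<open>Near a Dirichlet end all modes are multiples of sines of the distance \<open>g x\<close>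
  to that end, so their ratios converge to ratios of frequencies up to constants.\<close>

lemma end_regular_sine:
  assumes m: "\<And>k. k < N \<Longrightarrow> m k > 0" and A: "\<And>k. k < N \<Longrightarrow> A k \<noteq> 0"
    and f: "\<And>k. k < N \<Longrightarrow> eventually (\<lambda>x. f k x = A k * sin (m k * g x)) G"
    and g: "filterlim g (at 0) G" and q: "\<And>k. k < N \<Longrightarrow> (q k \<longlongrightarrow> z k) G"
  shows "end_regular G N f q"
  unfolding end_regular_def
proof (intro conjI allI impI)
  fix k assume k: "k < N"
  have g0: "(g \<longlongrightarrow> 0) G" using g by (simp add: filterlim_at)
  have "((\<lambda>x. A k * sin (m k * g x)) \<longlongrightarrow> A k * sin (m k * 0)) G"
    by (intro tendsto_intros g0)
  then have "((\<lambda>x. A k * sin (m k * g x)) \<longlongrightarrow> 0) G" by simp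
  moreover have "eventually (\<lambda>x. A k * sin (m k * g x) = f k x) G"
    using f[OF k] by eventually_elim simp
  ultimately show "(f k \<longlongrightarrow> 0) G" by (rule Lim_transform_eventually)
  show "\<exists>z. (q k \<longlongrightarrow> z) G" using q[OF k] by blast
  fix j assume j: "j < N"
  have "((\<lambda>x. sin (m k * g x) / sin (m j * g x)) \<longlongrightarrow> m k / m j) G"
    using filterlim_compose[OF tendsto_sin_ratio g] m[OF j] by auto
  then have "((\<lambda>x. A k / A j * (sin (m k * g x) / sin (m j * g x))) \<longlongrightarrow> A k / A j * (m k / m j)) G"
    by (rule tendsto_mult_left)
  moreover have "eventually (\<lambda>x. A k / A j * (sin (m k * g x) / sin (m j * g x)) = f k x / f j x) G"
    using f[OF k] f[OF j] by eventually_elim simp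
  ultimately have "((\<lambda>x. f k x / f j x) \<longlongrightarrow> A k / A j * (m k / m j)) G"
    by (rule Lim_transform_eventually)
  then show "\<exists>z. ((\<lambda>x. f k x / f j x) \<longlongrightarrow> z) G" by blast
qed

lemma filterlim_ident_at_right_0: "filterlim (\<lambda>x::real. x) (at 0) (at_right 0)"
  by (simp add: filterlim_at eventually_at_filter)

lemma filterlim_diff_at_left: "filterlim (\<lambda>x::real. b - x) (at 0) (at_left b)"
proof -
  have "((\<lambda>x. b - x) \<longlongrightarrow> b - b) (at_left b)" by (intro tendsto_intros)
  then show ?thesis by (simp add: filterlim_at eventually_at_filter)
qed

text \<open>The assumption is the Chebyshev property for every initial segment of functions and
  points. This lets the interpolation be extended point by point, without determinants.\<close>

lemma ex_interpolation:
  fixes \<phi> :: "nat \<Rightarrow> real \<Rightarrow> real" and y v :: "nat \<Rightarrow> real"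
  assumes "\<And>n C. n \<le> N \<Longrightarrow> \<exists>k<n. C k \<noteq> 0 \<Longrightarrow> \<exists>i<n. (\<Sum>k<n. C k * \<phi> k (y i)) \<noteq> 0"
  shows "\<exists>C. \<forall>i<N. (\<Sum>k<N. C k * \<phi> k (y i)) = v i"
proof -
  have "n \<le> N \<Longrightarrow> \<exists>C. \<forall>i<n. (\<Sum>k<n. C k * \<phi> k (y i)) = v i" for n and v :: "nat \<Rightarrow> real"
  proof (induction n arbitrary: v)
    case (Suc n)
    have "n \<le> N" using Suc.prems by simp
    obtain D where D: "\<forall>i<n. (\<Sum>k<n. D k * \<phi> k (y i)) = - \<phi> n (y i)"
      using Suc.IH[OF \<open>n \<le> N\<close>, of "\<lambda>i. - \<phi> n (y i)"] by blast
    obtain E where E: "\<forall>i<n. (\<Sum>k<n. E k * \<phi> k (y i)) = v i"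
      using Suc.IH[OF \<open>n \<le> N\<close>] by blast
    \<comment> \<open>\<open>w\<close> is the value at the new point of a combination that vanishes
      at all earlier points; being nonzero, it can correct the value at \<open>y n\<close> without
      disturbing the others.\<close>
    define w where "w = (\<Sum>k<n. D k * \<phi> k (y n)) + \<phi> n (y n)"
    have "w \<noteq> 0"
    proof
      assume "w = 0"
      then have "\<forall>i<Suc n. (\<Sum>k<Suc n. (D(n := 1)) k * \<phi> k (y i)) = 0"
        using D by (auto simp: w_def less_Suc_eq)
      moreover have "\<exists>k<Suc n. (D(n := 1)) k \<noteq> 0" by auto
      ultimately show False using assms[OF Suc.prems] by metis
    qed
    define t where "t = (v n - (\<Sum>k<n. E k * \<phi> k (y n))) / w"
    define C where "C k = (if k < n then E k + t * D k else t)" for k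
    have "(\<Sum>k<Suc n. C k * \<phi> k x) = (\<Sum>k<n. E k * \<phi> k x) + t * ((\<Sum>k<n. D k * \<phi> k x) + \<phi> n x)" for x
    proof -
      have "(\<Sum>k<n. C k * \<phi> k x) = (\<Sum>k<n. E k * \<phi> k x + t * (D k * \<phi> k x))"
        by (intro sum.cong) (auto simp: C_def algebra_simps)
      then show ?thesis by (simp add: C_def sum.distrib sum_distrib_left algebra_simps)
    qed
    then have "\<forall>i<Suc n. (\<Sum>k<Suc n. C k * \<phi> k (y i)) = v i"
      using D E \<open>w \<noteq> 0\<close> by (auto simp: less_Suc_eq t_def w_def[symmetric])
    then show ?case by blast
  qed simp
  then show ?thesis by blast
qed

lemma sign_changes_card_zeros:
  fixes y :: "nat \<Rightarrow> real"
  assumes y: "\<And>i. i < n \<Longrightarrow> y i \<in> {a<..<b}" "\<And>i. Suc i < n \<Longrightarrow> y i < y (Suc i)"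
    and g: "continuous_on {a<..<b} g" and sgn: "\<And>i. i < n \<Longrightarrow> g (y i) * (-1) ^ i > 0"
    and fin: "finite (zeros a b g)"
  shows "n \<le> card (zeros a b g) + 1"
proof -
  have mono: "y i \<le> y j" if "i \<le> j" "j < n" for i j
    using that
  proof (induction j)
    case (Suc j)
    then show ?case using y(2)[of j] by (cases "i = Suc j") (auto intro: order.trans[of _ "y j"])
  qed simp
  have "\<exists>z. y i < z \<and> z < y (Suc i) \<and> g z = 0" if i: "Suc i < n" for i
  proof -
    have sub: "{y i..y (Suc i)} \<subseteq> {a<..<b}" using y(1)[of i] y(1)[of "Suc i"] i by auto
    have s1: "g (y i) * (-1) ^ i > 0" "g (y (Suc i)) * (-1) ^ i < 0"
      using sgn[of i] sgn[of "Suc i"] i by auto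
    have "\<exists>z\<ge>y i. z \<le> y (Suc i) \<and> g z * (-1) ^ i = 0"
      by (rule IVT2') (use s1 y(2)[OF i] in \<open>auto intro!: continuous_intros continuous_on_subset[OF g sub]\<close>)
    then obtain z where z: "y i \<le> z" "z \<le> y (Suc i)" "g z = 0" by auto
    then have "z \<noteq> y i" "z \<noteq> y (Suc i)" using s1 by auto
    then show ?thesis using z by (intro exI[of _ z]) auto
  qed
  then obtain z where z: "\<And>i. Suc i < n \<Longrightarrow> y i < z i \<and> z i < y (Suc i) \<and> g (z i) = 0" by metis
  have z_less: "z i < z j" if "i < j" "Suc j < n" for i j
    using z[of i] z[of j] mono[of "Suc i" j] that by force
  have "inj_on z {..<n - 1}"
  proof (rule inj_onI, rule ccontr)
    fix i j assume "i \<in> {..<n - 1}" "j \<in> {..<n - 1}" "z i = z j" "i \<noteq> j"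
    then show False using z_less[of i j] z_less[of j i]
      by (cases i j rule: linorder_cases) (auto simp: less_diff_conv)
  qed
  moreover have "z ` {..<n - 1} \<subseteq> zeros a b g"
  proof
    fix x assume "x \<in> z ` {..<n - 1}"
    then obtain i where i: "Suc i < n" "x = z i" by (auto simp: less_diff_conv)
    then show "x \<in> zeros a b g" using z[of i] y(1)[of i] y(1)[of "Suc i"] by (auto simp: zeros_def)
  qed
  ultimately have "n - 1 \<le> card (zeros a b g)"
    using card_image[of z "{..<n - 1}"] card_mono[OF fin, of "z ` {..<n - 1}"] by simp
  then show ?thesis by simp
qed

text \<open>The mode seen from the degree-one vertex: \<open>star_mode l m j x\<close> equals
  \<open>profile m (l j) (l j - x)\<close>, with value 1 at the centre \<open>y = a\<close> whenever
  \<open>sin (m * a) \<noteq> 0\<close>.\<close>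

definition profile :: "real \<Rightarrow> real \<Rightarrow> real \<Rightarrow> real" where
  "profile m a y = sin (m * y) / sin (m * a)"

lemma profile_cont: "continuous_on S (profile m a)"
  unfolding profile_def[abs_def] divide_inverse by (intro continuous_intros)

lemma profile_deriv:
  assumes "sin (m * a) \<noteq> 0"
  shows "(profile m a has_real_derivative m * cos (m * y) / sin (m * a)) (at y)"
  unfolding profile_def[abs_def] using assms by (auto intro!: derivative_eq_intros)

section \<open>Chebyshev property on a single short edge\<close>

context short_star
begin

lemma inj_freq_sq: "inj_on (\<lambda>k. (freq k)\<^sup>2) {..<M}"
proof (rule inj_onI, rule ccontr)
  fix a b assume ab: "a \<in> {..<M}" "b \<in> {..<M}" "(freq a)\<^sup>2 = (freq b)\<^sup>2" "a \<noteq> b"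
  have "freq a = freq b"
    by (rule power2_eq_imp_eq[OF ab(3)]) (use freq_bounds(1)[of a] freq_bounds(1)[of b] ab in auto)
  then show False using ab freq_strict_mono[of a b] freq_strict_mono[of b a]
    by (cases a b rule: linorder_cases) auto
qed

text \<open>All sines involved stay within their first half-wave, so none vanishes inside the edge.
  Nothing is imposed at the centre, hence the value \<open>False\<close>. The weights are constant,
  and the midpoint merely serves as the exceptional point.\<close>

lemma short_edge_sl_system:
  assumes j: "1 \<le> j" "j \<le> s" and L: "L \<le> M"
  shows "sl_system False 0 (l j) (l j / 2) (\<lambda>_. 1) (\<lambda>_. 1) L (\<lambda>k. (freq k)\<^sup>2)
    (\<lambda>k. profile (freq k) (l j)) (\<lambda>k y. freq k * cos (freq k * y) / sin (freq k * l j))"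
proof -
  have pos: "sin (freq k * y) > 0" if "k < L" "0 < y" "y \<le> l j" for k y
  proof -
    have "freq k * y \<le> freq k * l j" using freq_bounds(1)[of k] that L by (intro mult_left_mono) auto
    also have "\<dots> < pi" using short_arg[OF j, of "freq k"] freq_bounds[of k] that L by auto
    finally show ?thesis using freq_bounds(1)[of k] that L by (intro sin_gt_zero) auto
  qed
  have nz: "sin (freq k * l j) \<noteq> 0" if "k < L" for k using pos[OF that, of "l j"] lpos[OF j] by auto
  have zeros: "zeros 0 (l j) (profile (freq k) (l j)) = {}" if "k < L" for k
    using pos[OF that] nz[OF that] by (force simp: zeros_def profile_def)
  show ?thesis
    unfolding sl_system_def
  proof (intro conjI allI impI ballI)
    show "0 < l j / 2" "l j / 2 < l j" using lpos[OF j] by auto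
    show "inj_on (\<lambda>k. (freq k)\<^sup>2) {..<L}"
      by (rule inj_on_subset[OF inj_freq_sq]) (use L in auto)
  next
    fix k x assume k: "k < L"
    show "continuous_on {0<..<l j} (profile (freq k) (l j))" by (rule profile_cont)
    show "continuous_on {0<..<l j} (\<lambda>y. freq k * cos (freq k * y) / sin (freq k * l j))"
      unfolding divide_inverse by (intro continuous_intros)
    show "finite (zeros 0 (l j) (profile (freq k) (l j)))"
      "card (zeros 0 (l j) (profile (freq k) (l j))) \<le> (if False then k else 0)"
      using zeros[OF k] by auto
    show "(profile (freq k) (l j) has_real_derivative 1 * (freq k * cos (freq k * x) / sin (freq k * l j))) (at x)"
      using profile_deriv[OF nz[OF k]] by simp
    show "((\<lambda>y. freq k * cos (freq k * y) / sin (freq k * l j)) has_real_derivative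
         - (freq k)\<^sup>2 * 1 * profile (freq k) (l j) x) (at x)"
      using nz[OF k] by (auto intro!: derivative_eq_intros simp: profile_def power2_eq_square)
  next
    show "end_regular (at_right 0) L (\<lambda>k. profile (freq k) (l j))
       (\<lambda>k y. freq k * cos (freq k * y) / sin (freq k * l j))"
    proof (rule end_regular_sine[OF _ _ _ filterlim_ident_at_right_0])
      fix k assume k: "k < L"
      show "freq k > 0" using freq_bounds(1)[of k] k L by simp
      show "1 / sin (freq k * l j) \<noteq> 0" using nz[OF k] by simp
      show "eventually (\<lambda>x. profile (freq k) (l j) x = 1 / sin (freq k * l j) * sin (freq k * x)) (at_right 0)"
        by (simp add: profile_def)
      show "((\<lambda>y. freq k * cos (freq k * y) / sin (freq k * l j)) \<longlongrightarrow>
          freq k * cos (freq k * 0) / sin (freq k * l j)) (at_right 0)"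
        by (intro tendsto_intros nz k)
    qed
  qed auto
qed

lemma short_edge_zeros:
  assumes "1 \<le> j" "j \<le> s" "L \<le> M" "\<exists>k<L. C k \<noteq> 0"
  shows "finite (zeros 0 (l j) (\<lambda>y. \<Sum>k<L. C k * profile (freq k) (l j) y))"
    "card (zeros 0 (l j) (\<lambda>y. \<Sum>k<L. C k * profile (freq k) (l j) y)) < L"
  using sl_zero_count[OF short_edge_sl_system[OF assms(1-3)] assms(4)] by auto

end

section \<open>The folded star with equal short edges\<close>

lemma glue_deriv:
  fixes g h :: "real \<Rightarrow> real"
  assumes "x \<noteq> c" "x < c \<Longrightarrow> (g has_real_derivative d) (at x)" "c < x \<Longrightarrow> (h has_real_derivative d) (at x)"
  shows "((\<lambda>t. if t \<le> c then g t else h t) has_real_derivative d) (at x)"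
proof (cases "x < c")
  case True
  show ?thesis
    by (rule has_field_derivative_transform_within_open[OF assms(2), of "{..<c}"]) (use True in auto)
next
  case False
  then have "c < x" using assms(1) by simp
  then show ?thesis
    by (intro has_field_derivative_transform_within_open[OF assms(3), of "{c<..}"]) auto
qed

lemma glue_continuous:
  fixes g h :: "real \<Rightarrow> real"
  assumes "continuous_on UNIV g" "continuous_on UNIV h" "g c = h c"
  shows "continuous_on S (\<lambda>t. if t \<le> c then g t else h t)"
proof (rule continuous_on_cases_le[where h = "\<lambda>t. t" and a = c])
  show "continuous_on {t \<in> S. t \<le> c} g" by (rule continuous_on_subset[OF assms(1)]) simp
  show "continuous_on {t \<in> S. c \<le> t} h" by (rule continuous_on_subset[OF assms(2)]) simp
  show "continuous_on S (\<lambda>t. t)" by (rule continuous_on_id)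
qed (use assms(3) in simp)

locale symmetric_star = short_star +
  fixes e :: real
  assumes equal: "\<And>j. 1 \<le> j \<Longrightarrow> j \<le> s \<Longrightarrow> l j = e"
begin

lemma e_pos: "e > 0" using lpos[of 1] equal[of 1] s by simp

lemma short_sin_pos:
  assumes "k < M" "0 < y" "y \<le> e"
  shows "sin (freq k * y) > 0"
proof -
  have "freq k * y \<le> freq k * e" using freq_bounds(1)[of k] assms by (intro mult_left_mono) auto
  also have "\<dots> < pi"
    using short_arg[of 1 "freq k"] equal[of 1] s freq_bounds[of k] assms by auto
  finally show ?thesis using freq_bounds(1)[of k] assms by (intro sin_gt_zero) auto
qed

lemma long_sin_nonzero: "k < M \<Longrightarrow> sin (freq k) \<noteq> 0"
  using sin_band_nonzero freq(1) by blast

text \<open>The folded star is the interval from 0 to e + 1. Its short part carries weight s, so that the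
  Kirchhoff condition becomes continuity of the flux.\<close>

definition glued :: "nat \<Rightarrow> real \<Rightarrow> real" where
  "glued k x = (if x \<le> e then profile (freq k) e x else profile (freq k) 1 (e + 1 - x))"

definition flux :: "nat \<Rightarrow> real \<Rightarrow> real" where
  "flux k x = (if x \<le> e then real s * (freq k * cos (freq k * x) / sin (freq k * e))
     else - (freq k * cos (freq k * (e + 1 - x)) / sin (freq k)))"

lemma flux_match:
  assumes k: "k < M"
  shows "real s * (freq k * cos (freq k * e) / sin (freq k * e)) = - (freq k * cos (freq k) / sin (freq k))"
proof -
  have "secular s l (freq k) = cot (freq k) + (\<Sum>j\<in>{1..s}. cot (freq k * l j))"
  proof -
    have "{..s} = insert 0 {1..s}" by auto
    then show ?thesis unfolding secular_def by (simp add: l0)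
  qed
  also have "(\<Sum>j\<in>{1..s}. cot (freq k * l j)) = (\<Sum>j\<in>{1..s}. cot (freq k * e))"
    by (intro sum.cong) (auto simp: equal)
  finally have "cot (freq k) + real s * cot (freq k * e) = 0" using freq(2)[OF k] by simp
  then have "real s * cot (freq k * e) = - cot (freq k)" by simp
  then have "freq k * (real s * cot (freq k * e)) = freq k * (- cot (freq k))" by simp
  then show ?thesis by (simp add: cot_def mult_ac)
qed

text \<open>The short part lies within the first half-wave. On the long part the zeros lie at
  distances \<open>i * pi / freq k\<close> from the end; as such a distance is at most 1 and
  \<open>freq k < pi * (k + 1)\<close>, only \<open>i = 1, ..., k\<close> are possible.\<close>

lemma glued_zeros:
  assumes k: "k < M"
  shows "finite (zeros 0 (e + 1) (glued k)) \<and> card (zeros 0 (e + 1) (glued k)) \<le> k"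
proof -
  have sub: "zeros 0 (e + 1) (glued k) \<subseteq> (\<lambda>i. e + 1 - real i * pi / freq k) ` {1..k}"
  proof
    fix x assume "x \<in> zeros 0 (e + 1) (glued k)"
    then have x: "0 < x" "x < e + 1" "glued k x = 0" by (auto simp: zeros_def)
    have "\<not> x \<le> e"
    proof
      assume "x \<le> e"
      then have "sin (freq k * x) / sin (freq k * e) = 0" using x by (simp add: glued_def profile_def)
      moreover have "sin (freq k * x) > 0" "sin (freq k * e) > 0"
        using x \<open>x \<le> e\<close> short_sin_pos[OF k] e_pos by auto
      ultimately show False by simp
    qed
    then have "sin (freq k * (e + 1 - x)) = 0"
      using x long_sin_nonzero[OF k] by (simp add: glued_def profile_def)
    then obtain i :: int where i: "freq k * (e + 1 - x) = of_int i * pi"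
      using sin_zero_iff_int2 by metis
    have "0 < of_int i * pi" using i x freq_bounds(1)[OF k] by (metis diff_gt_0_iff_gt mult_pos_pos)
    then have i0: "0 < i" by (simp add: zero_less_mult_iff)
    have "of_int i * pi \<le> freq k * 1"
      unfolding i[symmetric] using \<open>\<not> x \<le> e\<close> freq_bounds(1)[OF k] by (intro mult_left_mono) auto
    also have "\<dots> < pi * real (Suc k)" using freq(1)[OF k] by (simp add: band_def)
    finally have "pi * of_int i < pi * real (Suc k)" by (simp add: mult.commute)
    then have "of_int i < (of_int (int (Suc k)) :: real)" by simp
    then have "i < int (Suc k)" by (simp only: of_int_less_iff)
    then have "nat i \<in> {1..k}" using i0 by auto
    moreover have "x = e + 1 - real (nat i) * pi / freq k"
      using i i0 freq_bounds(1)[OF k] by (simp add: field_simps)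
    ultimately show "x \<in> (\<lambda>i. e + 1 - real i * pi / freq k) ` {1..k}" by blast
  qed
  have "card (zeros 0 (e + 1) (glued k)) \<le> card ((\<lambda>i. e + 1 - real i * pi / freq k) ` {1..k})"
    by (rule card_mono[OF _ sub]) simp
  also have "\<dots> \<le> card {1..k}" by (rule card_image_le) simp
  finally show ?thesis using finite_subset[OF sub] by simp
qed

text \<open>On the short part the flux is \<open>s\<close> times the derivative, which gives the
  weights \<open>1 / s\<close> and \<open>s\<close>; on the long part it is the derivative itself.
  The jump of the weights at \<open>e\<close> is the reason for allowing an exceptional
  point.\<close>

lemma glued_sl_system:
  assumes L: "L \<le> M"
  shows "sl_system True 0 (e + 1) e (\<lambda>x. if x \<le> e then 1 / real s else 1) (\<lambda>x. if x \<le> e then real s else 1)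
    L (\<lambda>k. (freq k)\<^sup>2) glued flux"
  unfolding sl_system_def
proof (intro conjI allI impI ballI)
  show "0 < e" "e < e + 1" using e_pos by auto
  show "inj_on (\<lambda>k. (freq k)\<^sup>2) {..<L}"
    by (rule inj_on_subset[OF inj_freq_sq]) (use L in auto)
next
  fix x :: real
  show "0 < (if x \<le> e then 1 / real s else 1)" "0 < (if x \<le> e then real s else 1)"
    using s by auto
next
  fix k x assume k': "k < L"
  then have k: "k < M" using L by simp
  have nz: "sin (freq k * e) \<noteq> 0" using short_sin_pos[OF k, of e] e_pos by simp
  note nz1 = long_sin_nonzero[OF k]
  show "continuous_on {0<..<e + 1} (glued k)"
    unfolding glued_def[abs_def]
  proof (rule glue_continuous)
    show "continuous_on UNIV (\<lambda>x. profile (freq k) 1 (e + 1 - x))"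
      unfolding profile_def divide_inverse by (intro continuous_intros)
    show "continuous_on UNIV (profile (freq k) e)" by (rule profile_cont)
  qed (use nz nz1 in \<open>simp add: profile_def\<close>)
  show "continuous_on {0<..<e + 1} (flux k)"
    unfolding flux_def[abs_def]
  proof (rule glue_continuous)
    show "continuous_on UNIV (\<lambda>x. real s * (freq k * cos (freq k * x) / sin (freq k * e)))"
      "continuous_on UNIV (\<lambda>x. - (freq k * cos (freq k * (e + 1 - x)) / sin (freq k)))"
      unfolding divide_inverse by (intro continuous_intros)+
  qed (use flux_match[OF k] in simp)
  show "finite (zeros 0 (e + 1) (glued k))" "card (zeros 0 (e + 1) (glued k)) \<le> (if True then k else 0)"
    using glued_zeros[OF k] by auto
  assume "x \<in> {0<..<e + 1} - {e}"
  then have x: "x \<noteq> e" by auto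
  show "(glued k has_real_derivative (if x \<le> e then 1 / real s else 1) * flux k x) (at x)"
    unfolding glued_def[abs_def]
  proof (rule glue_deriv[OF x])
    assume "x < e"
    then show "(profile (freq k) e has_real_derivative (if x \<le> e then 1 / real s else 1) * flux k x) (at x)"
      using profile_deriv[OF nz, of x] s by (simp add: flux_def)
  next
    assume "e < x"
    then show "((\<lambda>x. profile (freq k) 1 (e + 1 - x)) has_real_derivative
        (if x \<le> e then 1 / real s else 1) * flux k x) (at x)"
      unfolding profile_def using nz1 by (auto intro!: derivative_eq_intros simp: flux_def)
  qed
  show "(flux k has_real_derivative - (freq k)\<^sup>2 * (if x \<le> e then real s else 1) * glued k x) (at x)"
    unfolding flux_def[abs_def]
  proof (rule glue_deriv[OF x])
    assume "x < e"
    then show "((\<lambda>x. real s * (freq k * cos (freq k * x) / sin (freq k * e))) has_real_derivative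
        - (freq k)\<^sup>2 * (if x \<le> e then real s else 1) * glued k x) (at x)"
      using nz by (auto intro!: derivative_eq_intros simp: glued_def profile_def power2_eq_square)
  next
    assume "e < x"
    then show "((\<lambda>x. - (freq k * cos (freq k * (e + 1 - x)) / sin (freq k))) has_real_derivative
        - (freq k)\<^sup>2 * (if x \<le> e then real s else 1) * glued k x) (at x)"
      using nz1 by (auto intro!: derivative_eq_intros simp: glued_def profile_def power2_eq_square)
  qed
next
  have nz: "sin (freq k * e) \<noteq> 0" "sin (freq k) \<noteq> 0" "freq k > 0" if "k < L" for k
    using short_sin_pos[of k e] e_pos that L long_sin_nonzero[of k] freq_bounds(1)[of k] by auto
  show "end_regular (at_right 0) L glued flux"
  proof (rule end_regular_sine[OF nz(3) _ _ filterlim_ident_at_right_0])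
    fix k assume k: "k < L"
    have near: "eventually (\<lambda>x. x \<in> {0<..<e}) (at_right 0)" by (rule eventually_at_right_real[OF e_pos])
    show "1 / sin (freq k * e) \<noteq> 0" using nz[OF k] by simp
    show "eventually (\<lambda>x. glued k x = 1 / sin (freq k * e) * sin (freq k * x)) (at_right 0)"
      using near by eventually_elim (auto simp: glued_def profile_def)
    have "((\<lambda>x. real s * (freq k * cos (freq k * x) / sin (freq k * e))) \<longlongrightarrow>
        real s * (freq k * cos (freq k * 0) / sin (freq k * e))) (at_right 0)"
      by (intro tendsto_intros nz k)
    moreover have "eventually (\<lambda>x. real s * (freq k * cos (freq k * x) / sin (freq k * e)) = flux k x) (at_right 0)"
      using near by eventually_elim (auto simp: flux_def)
    ultimately show "(flux k \<longlongrightarrow> real s * (freq k * cos (freq k * 0) / sin (freq k * e))) (at_right 0)"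
      by (rule Lim_transform_eventually)
  qed
  show "end_regular (at_left (e + 1)) L glued flux"
  proof (rule end_regular_sine[OF nz(3) _ _ filterlim_diff_at_left])
    fix k assume k: "k < L"
    have near: "eventually (\<lambda>x. x \<in> {e<..<e + 1}) (at_left (e + 1))"
      by (rule eventually_at_left_real) simp
    show "1 / sin (freq k) \<noteq> 0" using nz[OF k] by simp
    show "eventually (\<lambda>x. glued k x = 1 / sin (freq k) * sin (freq k * (e + 1 - x))) (at_left (e + 1))"
      using near by eventually_elim (auto simp: glued_def profile_def)
    have "((\<lambda>x. - (freq k * cos (freq k * (e + 1 - x)) / sin (freq k))) \<longlongrightarrow>
        - (freq k * cos (freq k * (e + 1 - (e + 1))) / sin (freq k))) (at_left (e + 1))"
      by (intro tendsto_intros nz k)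
    moreover have "eventually (\<lambda>x. - (freq k * cos (freq k * (e + 1 - x)) / sin (freq k)) = flux k x) (at_left (e + 1))"
      using near by eventually_elim (auto simp: flux_def)
    ultimately show "(flux k \<longlongrightarrow> - (freq k * cos (freq k * (e + 1 - (e + 1))) / sin (freq k))) (at_left (e + 1))"
      by (rule Lim_transform_eventually)
  qed
qed

text \<open>A nontrivial combination of \<open>n\<close> modes vanishing at \<open>n\<close> points
  would exceed the bound \<open>n - 1\<close> on the short edge.\<close>

lemma symmetric_interpolation:
  assumes L: "L \<le> M" and y: "inj_on y {..<L}" "\<And>i. i < L \<Longrightarrow> y i \<in> {0<..<e}"
  shows "\<exists>C. \<forall>i<L. (\<Sum>k<L. C k * profile (freq k) e (y i)) = v i"
proof (rule ex_interpolation, rule ccontr)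
  fix n and C :: "nat \<Rightarrow> real"
  assume n: "n \<le> L" and C: "\<exists>k<n. C k \<noteq> 0" and z: "\<not> (\<exists>i<n. (\<Sum>k<n. C k * profile (freq k) e (y i)) \<noteq> 0)"
  let ?Z = "zeros 0 (l 1) (\<lambda>x. \<Sum>k<n. C k * profile (freq k) (l 1) x)"
  have Z: "finite ?Z" "card ?Z < n"
    using short_edge_zeros[of 1 n C] s n L C by auto
  have "y ` {..<n} \<subseteq> ?Z"
    using z y(2) n equal[of 1] s by (auto simp: zeros_def)
  then have "card (y ` {..<n}) \<le> card ?Z" by (rule card_mono[OF Z(1)])
  moreover have "card (y ` {..<n}) = n"
    using card_image[OF inj_on_subset[OF y(1), of "{..<n}"]] n by auto
  ultimately show False using Z(2) by simp
qed

text \<open>The short part already holds the \<open>L - 1\<close> zeros allowed on the whole folded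
  interval; \<open>y = 1\<close> is the centre. The sum in the second claim is the slope at the far
  end: were it 0, the sharpened count would leave at most \<open>L - 2\<close> zeros.\<close>

lemma symmetric_long_edge:
  assumes L: "L \<le> M" and C: "\<exists>k<L. C k \<noteq> 0"
    and many: "L \<le> card (zeros 0 e (\<lambda>x. \<Sum>k<L. C k * profile (freq k) e x)) + 1"
  shows "\<And>y. y \<in> {0<..1} \<Longrightarrow> (\<Sum>k<L. C k * profile (freq k) 1 y) \<noteq> 0"
    and "(\<Sum>k<L. C k * (freq k / sin (freq k))) \<noteq> 0"
proof -
  let ?S = "\<lambda>x. \<Sum>k<L. C k * glued k x"
  let ?Z = "zeros 0 (e + 1) ?S"
  let ?Y = "zeros 0 e (\<lambda>x. \<Sum>k<L. C k * profile (freq k) e x)"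
  note count = sl_zero_count[OF glued_sl_system[OF L] C]
  have YZ: "?Y \<subseteq> ?Z" by (auto simp: zeros_def glued_def)
  show "(\<Sum>k<L. C k * profile (freq k) 1 y) \<noteq> 0" if y: "y \<in> {0<..1}" for y
  proof
    assume z: "(\<Sum>k<L. C k * profile (freq k) 1 y) = 0"
    have same: "glued k (e + 1 - y) = profile (freq k) 1 y" if "k < L" for k
    proof (cases "y = 1")
      case True
      then show ?thesis using that L short_sin_pos[of k e] e_pos long_sin_nonzero[of k]
        by (simp add: glued_def profile_def)
    qed (use y in \<open>auto simp: glued_def\<close>)
    have "?S (e + 1 - y) = 0" using z same by simp
    then have "insert (e + 1 - y) ?Y \<subseteq> ?Z" using YZ y e_pos by (auto simp: zeros_def)
    then have "card (insert (e + 1 - y) ?Y) \<le> card ?Z" using count by (intro card_mono) auto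
    moreover have "e + 1 - y \<notin> ?Y" using y by (auto simp: zeros_def)
    moreover have "finite ?Y" using count YZ finite_subset by blast
    ultimately show False using count many by simp
  qed
  show "(\<Sum>k<L. C k * (freq k / sin (freq k))) \<noteq> 0"
  proof
    assume z: "(\<Sum>k<L. C k * (freq k / sin (freq k))) = 0"
    have "L > 0" using C by auto
    then have M: "0 < M" using L by simp
    have ev: "eventually (\<lambda>x. x \<in> {e<..<e + 1}) (at_left (e + 1))"
      by (rule eventually_at_left_real) simp
    \<comment> \<open>\<open>?r k t\<close> is the quotient of \<open>glued k\<close> and
      \<open>glued 0\<close> at distance \<open>t\<close> from the far end. The weighted sum of its
      limits is the end slope up to a nonzero factor.\<close>
    let ?r = "\<lambda>k t. sin (freq 0) / sin (freq k) * (sin (freq k * t) / sin (freq 0 * t))"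
    have "((\<lambda>x. ?r k (e + 1 - x)) \<longlongrightarrow> sin (freq 0) / sin (freq k) * (freq k / freq 0)) (at_left (e + 1))"
      if "k < L" for k
      by (rule tendsto_mult_left, rule filterlim_compose[OF tendsto_sin_ratio filterlim_diff_at_left])
        (use freq_bounds(1)[OF M] in simp)
    then have "((\<lambda>x. \<Sum>k<L. C k * ?r k (e + 1 - x)) \<longlongrightarrow>
        (\<Sum>k<L. C k * (sin (freq 0) / sin (freq k) * (freq k / freq 0)))) (at_left (e + 1))"
      by (intro tendsto_sum tendsto_mult_left[of "\<lambda>x. ?r _ (e + 1 - x)"]) simp
    moreover have "(\<Sum>k<L. C k * (sin (freq 0) / sin (freq k) * (freq k / freq 0)))
        = sin (freq 0) / freq 0 * (\<Sum>k<L. C k * (freq k / sin (freq k)))"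
      unfolding sum_distrib_left by (intro sum.cong) (auto simp: field_simps)
    moreover have "eventually (\<lambda>x. (\<Sum>k<L. C k * ?r k (e + 1 - x)) = ?S x / glued 0 x) (at_left (e + 1))"
      using ev
    proof eventually_elim
      case (elim x)
      then show ?case
        unfolding sum_divide_distrib by (intro sum.cong) (auto simp: glued_def profile_def)
    qed
    ultimately have "((\<lambda>x. ?S x / glued 0 x) \<longlongrightarrow> 0) (at_left (e + 1))"
      using Lim_transform_eventually z by force
    then have "card ?Z + 1 < L" using count by simp
    moreover have "card ?Y \<le> card ?Z" using count YZ by (intro card_mono) auto
    ultimately show False using many by simp
  qed
qed

end

text \<open>On each short edge the Chebyshev bound and the assumption \<open>short\<close> meet at
  exactly \<open>L - 1\<close> zeros, while \<open>long\<close> excludes the long edge and, through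
  \<open>y = 1\<close>, the centre. The total \<open>s * (L - 1)\<close> is the required
  number.\<close>

lemma (in short_star) star_mode_combination_zeros:
  assumes inc: "incommensurable s l" and enum: "eigen_enumeration s l Lam F" and L: "1 \<le> L" "L \<le> M"
    and long: "\<And>y. y \<in> {0<..1} \<Longrightarrow> (\<Sum>k<L. C k * profile (freq k) 1 y) \<noteq> 0"
    and short: "\<And>j. 1 \<le> j \<Longrightarrow> j \<le> s \<Longrightarrow>
      L \<le> card (zeros 0 (l j) (\<lambda>y. \<Sum>k<L. C k * profile (freq k) (l j) y)) + 1"
  shows "\<exists>c. has_exactly_zeros s l (\<lambda>j x. \<Sum>k<L. c k * F k j x) (L - 1 + (L - 1) * (s - 1))"
proof -
  have "\<forall>k<L. \<exists>A. A \<noteq> 0 \<and> (\<forall>j x. j \<le> s \<longrightarrow> x \<in> {0..l j} \<longrightarrow> F k j x = A * star_mode l (freq k) j x)"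
  proof (intro allI impI)
    fix k assume "k < L"
    then have "k < M" using L by simp
    from enumeration_low[OF inc enum this]
    show "\<exists>A. A \<noteq> 0 \<and> (\<forall>j x. j \<le> s \<longrightarrow> x \<in> {0..l j} \<longrightarrow> F k j x = A * star_mode l (freq k) j x)"
      by metis
  qed
  then obtain A where A: "\<And>k. k < L \<Longrightarrow> A k \<noteq> 0"
    "\<And>k j x. k < L \<Longrightarrow> j \<le> s \<Longrightarrow> x \<in> {0..l j} \<Longrightarrow> F k j x = A k * star_mode l (freq k) j x"
    by metis
  let ?g = "\<lambda>j y. \<Sum>k<L. C k * profile (freq k) (l j) y"
  \<comment> \<open>Dividing by \<open>A k\<close> undoes the arbitrary scaling of the
    eigenfunctions in the enumeration.\<close>
  let ?f = "\<lambda>j x. \<Sum>k<L. C k / A k * F k j x"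
  let ?Z = "\<lambda>j. zeros 0 (l j) (?g j)"
  have f: "?f j x = ?g j (l j - x)" if "j \<le> s" "x \<in> {0..l j}" for j x
    by (intro sum.cong) (use A that in \<open>auto simp: star_mode_def profile_def\<close>)
  have C: "\<exists>k<L. C k \<noteq> 0"
  proof (rule ccontr)
    assume "\<not> ?thesis"
    then show False using long[of 1] by simp
  qed
  have Z: "finite (?Z j)" "card (?Z j) = L - 1" if "1 \<le> j" "j \<le> s" for j
    using short_edge_zeros[OF that L(2) C] short[OF that] by auto
  have eq: "zero_set s l ?f = (SIGMA j:{1..s}. (\<lambda>y. l j - y) ` ?Z j)"
  proof (intro set_eqI iffI)
    fix p assume "p \<in> zero_set s l ?f"
    then have p: "p \<in> graph_points s l" "?f (fst p) (snd p) = 0" by (auto simp: zero_set_def)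
    obtain j x where jx: "p = (j, x)" by (cases p)
    have cases: "(j = 0 \<and> x = 0) \<or> (j \<le> s \<and> 0 < x \<and> x < l j)"
      using p(1) jx by (auto simp: graph_points_def)
    then have js: "j \<le> s" and xs: "x \<in> {0..l j}" using l0 by auto
    have g0: "?g j (l j - x) = 0" using p(2) f[OF js xs] jx by simp
    have "j \<noteq> 0"
    proof
      assume "j = 0"
      then have "l j - x \<in> {0<..1}" using cases l0 by auto
      then show False using long[of "l j - x"] g0 \<open>j = 0\<close> l0 by simp
    qed
    then have x: "0 < x" "x < l j" using cases by auto
    then have "l j - x \<in> ?Z j" using g0 by (simp add: zeros_def)
    then have "x \<in> (\<lambda>y. l j - y) ` ?Z j" by (rule rev_image_eqI) simp
    then show "p \<in> (SIGMA j:{1..s}. (\<lambda>y. l j - y) ` ?Z j)" using jx js \<open>j \<noteq> 0\<close> by simp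
  next
    fix p assume "p \<in> (SIGMA j:{1..s}. (\<lambda>y. l j - y) ` ?Z j)"
    then obtain j y where jy: "p = (j, l j - y)" "1 \<le> j" "j \<le> s" "y \<in> ?Z j" by auto
    then have y: "0 < y" "y < l j" "?g j y = 0" by (auto simp: zeros_def)
    have "?f j (l j - y) = 0" using f[of j "l j - y"] y jy by simp
    then show "p \<in> zero_set s l ?f" using jy y by (auto simp: zero_set_def graph_points_def)
  qed
  have "card ((\<lambda>y. l j - y) ` ?Z j) = L - 1" if "1 \<le> j" "j \<le> s" for j
    using Z[OF that] by (subst card_image) (auto intro: inj_onI)
  then have "card (zero_set s l ?f) = s * (L - 1)"
    unfolding eq using Z by (subst card_SigmaI) auto
  also have "s * (L - 1) = L - 1 + (L - 1) * (s - 1)" using s by (cases s) (simp_all add: mult.commute)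
  finally have "card (zero_set s l ?f) = L - 1 + (L - 1) * (s - 1)" .
  moreover have "finite (zero_set s l ?f)" unfolding eq using Z by (intro finite_SigmaI) auto
  ultimately show ?thesis
    unfolding has_exactly_zeros_def by (intro exI[of _ "\<lambda>k. C k / A k"]) simp
qed

section \<open>Perturbation to incommensurable lengths\<close>

text \<open>The quotient of \<open>\<bar>g y\<bar>\<close> by \<open>y\<close>, extended by
  \<open>\<bar>D\<bar>\<close> at 0, is continuous and positive on a compact interval; its minimum
  serves as \<delta>. The bound is linear because \<open>g\<close> vanishes at 0.\<close>

lemma linear_lower_bound:
  fixes g :: "real \<Rightarrow> real"
  assumes cont: "continuous_on {0..1} g" and d: "(g has_real_derivative D) (at 0)"
    and z: "g 0 = 0" "D \<noteq> 0" "\<And>y. y \<in> {0<..1} \<Longrightarrow> g y \<noteq> 0"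
  obtains \<delta> where "\<delta> > 0" "\<And>y. y \<in> {0<..1} \<Longrightarrow> \<delta> * y \<le> \<bar>g y\<bar>"
proof -
  define h where "h y = (if y = 0 then \<bar>D\<bar> else \<bar>g y\<bar> / y)" for y
  have "((\<lambda>y. g y / y) \<longlongrightarrow> D) (at 0)" using d z by (simp add: has_field_derivative_iff)
  then have "((\<lambda>y. \<bar>g y / y\<bar>) \<longlongrightarrow> \<bar>D\<bar>) (at 0)" by (rule tendsto_rabs)
  then have lim: "((\<lambda>y. \<bar>g y / y\<bar>) \<longlongrightarrow> \<bar>D\<bar>) (at 0 within {0..1})"
    by (rule tendsto_within_subset) simp
  have conth: "continuous_on {0..1} h"
    unfolding continuous_on_def
  proof
    fix y :: real assume y: "y \<in> {0..1}"
    show "(h \<longlongrightarrow> h y) (at y within {0..1})"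
    proof (cases "y = 0")
      case True
      have "eventually (\<lambda>y. \<bar>g y / y\<bar> = h y) (at 0 within {0..1})"
        by (auto simp: eventually_at_filter h_def abs_divide)
      with lim have "(h \<longlongrightarrow> \<bar>D\<bar>) (at 0 within {0..1})" by (rule Lim_transform_eventually)
      then show ?thesis using True by (simp add: h_def)
    next
      case False
      have "((\<lambda>y. \<bar>g y\<bar> / y) \<longlongrightarrow> \<bar>g y\<bar> / y) (at y within {0..1})"
        using cont y False by (intro tendsto_intros) (auto simp: continuous_on_def)
      moreover have "eventually (\<lambda>t. \<bar>g t\<bar> / t = h t) (at y within {0..1})"
        unfolding eventually_at_filter using t1_space_nhds[OF False]
        by eventually_elim (simp add: h_def)
      ultimately have "(h \<longlongrightarrow> \<bar>g y\<bar> / y) (at y within {0..1})" by (rule Lim_transform_eventually)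
      then show ?thesis using False by (simp add: h_def)
    qed
  qed
  obtain t where t: "t \<in> {0..1}" "\<And>y. y \<in> {0..1} \<Longrightarrow> h t \<le> h y"
    using continuous_attains_inf[OF _ _ conth] by auto
  have "h t > 0" using t(1) z by (auto simp: h_def)
  moreover have "h t * y \<le> \<bar>g y\<bar>" if "y \<in> {0<..1}" for y
    using t(2)[of y] that by (simp add: h_def field_simps)
  ultimately show thesis by (rule that)
qed

lemma abs_sin_diff_le: "\<bar>sin a - sin b\<bar> \<le> \<bar>a - b\<bar>" for a b :: real
proof -
  have "\<bar>sin a - sin b\<bar> = 2 * \<bar>sin ((a - b) / 2)\<bar> * \<bar>cos ((a + b) / 2)\<bar>"
    by (simp add: sin_diff_sin abs_mult)
  also have "\<dots> \<le> 2 * \<bar>(a - b) / 2\<bar> * 1"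
    by (intro mult_mono mult_left_mono abs_sin_x_le_abs_x abs_cos_le_one) auto
  finally show ?thesis by simp
qed

text \<open>Both functions vanish at \<open>y = 0\<close>, so the perturbation has to be controlled
  relative to \<open>y\<close>: it is at most a small constant times \<open>y\<close>, against the
  lower bound \<open>\<delta> * y\<close> for the limit function.\<close>

lemma eventually_long_edge_nonzero:
  fixes m :: "real \<Rightarrow> nat \<Rightarrow> real" and n :: "nat \<Rightarrow> real"
  assumes m: "\<And>k. k < L \<Longrightarrow> ((\<lambda>u. m u k) \<longlongrightarrow> n k) G" and sn: "\<And>k. k < L \<Longrightarrow> sin (n k) \<noteq> 0"
    and nz: "\<And>y. y \<in> {0<..1} \<Longrightarrow> (\<Sum>k<L. C k * profile (n k) 1 y) \<noteq> 0"
    and D: "(\<Sum>k<L. C k * (n k / sin (n k))) \<noteq> 0"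
  shows "eventually (\<lambda>u. \<forall>y\<in>{0<..1}. (\<Sum>k<L. C k * profile (m u k) 1 y) \<noteq> 0) G"
proof -
  let ?g = "\<lambda>y. \<Sum>k<L. C k * profile (n k) 1 y"
  have "(?g has_real_derivative (\<Sum>k<L. C k * (n k * cos (n k * 0) / sin (n k * 1)))) (at 0)"
    by (intro DERIV_sum DERIV_cmult profile_deriv) (use sn in auto)
  then have der: "(?g has_real_derivative (\<Sum>k<L. C k * (n k / sin (n k)))) (at 0)" by simp
  have cont: "continuous_on {0..1} ?g" by (intro continuous_intros profile_cont)
  have g0: "?g 0 = 0" by (simp add: profile_def)
  obtain \<delta> where \<delta>: "\<delta> > 0" "\<And>y. y \<in> {0<..1} \<Longrightarrow> \<delta> * y \<le> \<bar>?g y\<bar>"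
    using linear_lower_bound[OF cont der g0 D nz] by blast
  \<comment> \<open>The two terms account for the change of frequency inside the sine and for the
    change of the normalising factor.\<close>
  define b where "b u k = \<bar>m u k - n k\<bar> / \<bar>sin (m u k)\<bar> + \<bar>n k\<bar> * \<bar>1 / sin (m u k) - 1 / sin (n k)\<bar>" for u k
  have lim: "((\<lambda>u. b u k) \<longlongrightarrow> \<bar>n k - n k\<bar> / \<bar>sin (n k)\<bar> + \<bar>n k\<bar> * \<bar>1 / sin (n k) - 1 / sin (n k)\<bar>) G"
    if "k < L" for k
  proof -
    have "((\<lambda>u. sin (m u k)) \<longlongrightarrow> sin (n k)) G" by (rule tendsto_sin[OF m[OF that]])
    then show ?thesis
      unfolding b_def by (intro tendsto_intros m[OF that]) (use sn[OF that] in auto)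
  qed
  have "((\<lambda>u. \<Sum>k<L. \<bar>C k\<bar> * b u k) \<longlongrightarrow> (\<Sum>k<L. \<bar>C k\<bar> * 0)) G"
    by (intro tendsto_sum tendsto_mult_left) (use lim in auto)
  then have "((\<lambda>u. \<Sum>k<L. \<bar>C k\<bar> * b u k) \<longlongrightarrow> 0) G" by simp
  then have "eventually (\<lambda>u. (\<Sum>k<L. \<bar>C k\<bar> * b u k) < \<delta>) G" using \<delta>(1) by (rule order_tendstoD)
  then show ?thesis
  proof eventually_elim
    case (elim u)
    show ?case
    proof
      fix y :: real assume y: "y \<in> {0<..1}"
      have pb: "\<bar>profile (m u k) 1 y - profile (n k) 1 y\<bar> \<le> b u k * y" for k
      proof -
        have "profile (m u k) 1 y - profile (n k) 1 y =
            (sin (m u k * y) - sin (n k * y)) / sin (m u k) + sin (n k * y) * (1 / sin (m u k) - 1 / sin (n k))"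
          by (simp add: profile_def diff_divide_distrib algebra_simps)
        also have "\<bar>\<dots>\<bar> \<le> \<bar>sin (m u k * y) - sin (n k * y)\<bar> / \<bar>sin (m u k)\<bar>
            + \<bar>sin (n k * y)\<bar> * \<bar>1 / sin (m u k) - 1 / sin (n k)\<bar>"
          by (rule order_trans[OF abs_triangle_ineq]) (simp add: abs_mult)
        also have "\<dots> \<le> \<bar>m u k * y - n k * y\<bar> / \<bar>sin (m u k)\<bar> + \<bar>n k * y\<bar> * \<bar>1 / sin (m u k) - 1 / sin (n k)\<bar>"
          by (intro add_mono divide_right_mono mult_right_mono abs_sin_diff_le abs_sin_x_le_abs_x) auto
        also have "\<dots> = b u k * y"
        proof -
          have "\<bar>m u k * y - n k * y\<bar> = \<bar>m u k - n k\<bar> * y" "\<bar>n k * y\<bar> = \<bar>n k\<bar> * y"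
            using y by (simp_all add: abs_mult flip: left_diff_distrib)
          then show ?thesis by (simp add: b_def algebra_simps)
        qed
        finally show ?thesis .
      qed
      have "\<bar>(\<Sum>k<L. C k * profile (m u k) 1 y) - ?g y\<bar> = \<bar>\<Sum>k<L. C k * (profile (m u k) 1 y - profile (n k) 1 y)\<bar>"
        by (simp add: sum_subtractf right_diff_distrib)
      also have "\<dots> \<le> (\<Sum>k<L. \<bar>C k\<bar> * (b u k * y))"
        by (rule order_trans[OF sum_abs], rule sum_mono) (use pb in \<open>auto simp: abs_mult intro!: mult_left_mono\<close>)
      also have "\<dots> = (\<Sum>k<L. \<bar>C k\<bar> * b u k) * y" by (simp add: sum_distrib_right mult.assoc)
      also have "\<dots> < \<delta> * y" using elim y by (intro mult_strict_right_mono) auto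
      also have "\<dots> \<le> \<bar>?g y\<bar>" by (rule \<delta>(2)[OF y])
      finally show "(\<Sum>k<L. C k * profile (m u k) 1 y) \<noteq> 0" by auto
    qed
  qed
qed

text \<open>At \<open>u = 1\<close> this is the equal-length star; the divisor \<open>M + 1\<close>
  keeps the short edges below 1/M and is rational, so it does not affect commensurability.\<close>

definition star_family :: "nat \<Rightarrow> real \<Rightarrow> nat \<Rightarrow> real" where
  "star_family M u j = (if j = 0 then 1 else u ^ j / (real M + 1))"

lemma short_star_family:
  assumes "0 < s" "0 < u" "u \<le> 1"
  shows "short_star s M (star_family M u)"
proof
  fix j assume j: "1 \<le> j" "j \<le> s"
  have "u ^ j * real M \<le> 1 * real M" using assms by (intro mult_right_mono power_le_one) auto
  also have "\<dots> < real M + 1" by simp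
  finally show "star_family M u j * real M < 1" using j by (simp add: star_family_def field_simps)
  show "0 < star_family M u j" using assms by (auto simp: star_family_def)
qed (use assms in \<open>auto simp: star_family_def\<close>)

lemma symmetric_star_family: "0 < s \<Longrightarrow> symmetric_star s M (star_family M 1) (1 / (real M + 1))"
  unfolding symmetric_star_def symmetric_star_axioms_def
  using short_star_family[of s 1 M] by (auto simp: star_family_def)

lemma star_family_tendsto: "((\<lambda>u. star_family M u j) \<longlongrightarrow> star_family M 1 j) (at_left 1)"
proof (cases "j = 0")
  case False
  have "((\<lambda>u. u ^ j / (real M + 1)) \<longlongrightarrow> 1 ^ j / (real M + 1)) (at_left 1)"
    by (intro tendsto_intros) auto
  then show ?thesis using False by (simp add: star_family_def)
qed (simp add: star_family_def)

text \<open>At a test point beside the limit frequency the secular function has a strict sign, which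
  persists for \<open>u\<close> near 1. As the perturbed secular functions also decrease strictly on
  the band, this sign locates their roots.\<close>

lemma freq_tendsto:
  assumes s: "0 < s" and k: "k < M"
  shows "((\<lambda>u. short_star.freq s (star_family M u) k) \<longlongrightarrow> short_star.freq s (star_family M 1) k) (at_left 1)"
proof -
  interpret P: short_star s M "star_family M 1" by (rule short_star_family) (use s in auto)
  let ?m = "\<lambda>u. short_star.freq s (star_family M u) k"
  have near: "eventually (\<lambda>u. 0 < u \<and> u \<le> 1) (at_left (1::real))"
    using eventually_at_left_real[of 0 "1::real"] by (auto elim!: eventually_mono)
  have lim: "((\<lambda>u. secular s (star_family M u) a) \<longlongrightarrow> secular s (star_family M 1) a) (at_left 1)"
    if "a \<in> P.band k" for a
    unfolding secular_def
    by (intro tendsto_intros star_family_tendsto) (use P.sin_nonzero[OF k that] in auto)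
  have lo: "pi * real k < P.freq k" and hi: "P.freq k < pi * real (Suc k)"
    using P.freq(1)[OF k] by (auto simp: P.band_def)
  show ?thesis
  proof (rule order_tendstoI)
    fix a assume a: "a < P.freq k"
    obtain a' where a': "max a (pi * real k) < a'" "a' < P.freq k"
      using dense[of "max a (pi * real k)" "P.freq k"] a lo by auto
    have ab: "a' \<in> P.band k" using a' hi by (auto simp: P.band_def)
    have "secular s (star_family M 1) a' > 0"
      using P.secular_strict_decreasing[OF k ab P.freq(1)[OF k] a'(2)] P.freq(2)[OF k] by simp
    then have "eventually (\<lambda>u. secular s (star_family M u) a' > 0) (at_left 1)"
      by (rule order_tendstoD(1)[OF lim[OF ab]])
    with near show "eventually (\<lambda>u. a < ?m u) (at_left 1)"
    proof eventually_elim
      case (elim u)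
      interpret Q: short_star s M "star_family M u" by (rule short_star_family) (use s elim in auto)
      have "\<not> ?m u \<le> a'"
      proof
        assume "?m u \<le> a'"
        then have "secular s (star_family M u) a' \<le> 0"
          using Q.secular_strict_decreasing[OF k Q.freq(1)[OF k] ab] Q.freq(2)[OF k]
          by (cases "?m u = a'") auto
        then show False using elim by simp
      qed
      then show ?case using a' by simp
    qed
  next
    fix a assume a: "P.freq k < a"
    obtain a' where a': "P.freq k < a'" "a' < min a (pi * real (Suc k))"
      using dense[of "P.freq k" "min a (pi * real (Suc k))"] a hi by auto
    have ab: "a' \<in> P.band k" using a' lo by (auto simp: P.band_def)
    have "secular s (star_family M 1) a' < 0"
      using P.secular_strict_decreasing[OF k P.freq(1)[OF k] ab a'(1)] P.freq(2)[OF k] by simp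
    then have "eventually (\<lambda>u. secular s (star_family M u) a' < 0) (at_left 1)"
      by (rule order_tendstoD(2)[OF lim[OF ab]])
    with near show "eventually (\<lambda>u. ?m u < a) (at_left 1)"
    proof eventually_elim
      case (elim u)
      interpret Q: short_star s M "star_family M u" by (rule short_star_family) (use s elim in auto)
      have "\<not> a' \<le> ?m u"
      proof
        assume "a' \<le> ?m u"
        then have "secular s (star_family M u) a' \<ge> 0"
          using Q.secular_strict_decreasing[OF k ab Q.freq(1)[OF k]] Q.freq(2)[OF k]
          by (cases "?m u = a'") auto
        then show False using elim by simp
      qed
      then show ?case using a' by simp
    qed
  qed
qed

text \<open>The coefficients do not depend on \<open>u\<close>, so the same \<open>C\<close> can be
  followed from the equal-length star to its perturbations.\<close>

definition good_combination :: "nat \<Rightarrow> nat \<Rightarrow> nat \<Rightarrow> (nat \<Rightarrow> real) \<Rightarrow> real \<Rightarrow> bool" where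
  "good_combination s M L C u \<longleftrightarrow>
     (\<forall>y\<in>{0<..1}. (\<Sum>k<L. C k * profile (short_star.freq s (star_family M u) k) 1 y) \<noteq> 0) \<and>
     (\<forall>j\<in>{1..s}. L \<le> card (zeros 0 (star_family M u j)
        (\<lambda>y. \<Sum>k<L. C k * profile (short_star.freq s (star_family M u) k) (star_family M u j) y)) + 1)"

lemma eventually_good_combination:
  assumes s: "0 < s" and L1: "1 \<le> L" and L: "L \<le> M"
  shows "\<exists>C. eventually (good_combination s M L C) (at_left 1)"
proof -
  define e where "e = 1 / (real M + 1)"
  interpret P: symmetric_star s M "star_family M 1" e
    unfolding e_def by (rule symmetric_star_family[OF s])
  let ?m = "\<lambda>u k. short_star.freq s (star_family M u) k"
  \<comment> \<open>Equidistant points strictly inside the short edge: \<open>Suc L\<close>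
    subintervals have exactly \<open>L\<close> interior division points.\<close>
  define y where "y i = e * real (Suc i) / real (Suc L)" for i
  have y_less: "y i < y j" if "i < j" for i j
    using that P.e_pos by (auto simp: y_def intro!: divide_strict_right_mono mult_strict_left_mono)
  have y_int: "0 < y i" "y i < e" if "i < L" for i
  proof -
    show "0 < y i" unfolding y_def using P.e_pos by (intro divide_pos_pos mult_pos_pos) auto
    have "y i < e * real (Suc L) / real (Suc L)"
      unfolding y_def using that P.e_pos by (intro divide_strict_right_mono mult_strict_left_mono) auto
    then show "y i < e" by simp
  qed
  have "inj_on y {..<L}"
    by (rule linorder_inj_onI) (use y_less in \<open>force+\<close>)
  \<comment> \<open>Alternating values at \<open>L\<close> points force \<open>L - 1\<close> sign
    changes.\<close>
  then obtain C where C: "\<And>i. i < L \<Longrightarrow> (\<Sum>k<L. C k * profile (P.freq k) e (y i)) = (-1) ^ i"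
    using P.symmetric_interpolation[OF L, of y "\<lambda>i. (-1) ^ i"] y_int by auto
  have C0: "\<exists>k<L. C k \<noteq> 0"
  proof (rule ccontr)
    assume "\<not> ?thesis"
    then show False using C[of 0] L1 by simp
  qed
  have e1: "star_family M 1 1 = e" by (simp add: star_family_def e_def)
  have Z: "finite (zeros 0 e (\<lambda>x. \<Sum>k<L. C k * profile (P.freq k) e x))"
    using P.short_edge_zeros(1)[of 1 L C] s L C0 e1 by simp
  have many: "L \<le> card (zeros 0 e (\<lambda>x. \<Sum>k<L. C k * profile (P.freq k) e x)) + 1"
  proof (rule sign_changes_card_zeros[of L y, OF _ _ _ _ Z])
    show "continuous_on {0<..<e} (\<lambda>x. \<Sum>k<L. C k * profile (P.freq k) e x)"
      by (intro continuous_intros profile_cont)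
    show "0 < (\<Sum>k<L. C k * profile (P.freq k) e (y i)) * (- 1) ^ i" if "i < L" for i
      using C[OF that] by (simp flip: power_add power_mult_distrib)
  qed (use y_int y_less in auto)
  have lim: "((\<lambda>u. ?m u k) \<longlongrightarrow> P.freq k) (at_left 1)" if "k < L" for k
    using freq_tendsto[OF s, of k M] that L by simp
  have long: "eventually (\<lambda>u. \<forall>y\<in>{0<..1}. (\<Sum>k<L. C k * profile (?m u k) 1 y) \<noteq> 0) (at_left 1)"
    by (rule eventually_long_edge_nonzero[OF lim])
      (use P.long_sin_nonzero L P.symmetric_long_edge[OF L C0 many] in auto)
  have "eventually (\<lambda>u. 0 < (\<Sum>k<L. C k * profile (?m u k) (star_family M u j) (y i)) * (-1) ^ i) (at_left 1)"
    if j: "1 \<le> j" "j \<le> s" and i: "i < L" for i j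
  proof (rule order_tendstoD(1))
    have nz: "sin (P.freq k * star_family M 1 j) \<noteq> 0" if "k < L" for k
      using P.sin_nonzero[of k "P.freq k" j] P.freq(1)[of k] that L j by simp
    show "((\<lambda>u. (\<Sum>k<L. C k * profile (?m u k) (star_family M u j) (y i)) * (-1) ^ i) \<longlongrightarrow>
       (\<Sum>k<L. C k * profile (P.freq k) (star_family M 1 j) (y i)) * (-1) ^ i) (at_left 1)"
      unfolding profile_def by (intro tendsto_intros lim star_family_tendsto nz) auto
    show "0 < (\<Sum>k<L. C k * profile (P.freq k) (star_family M 1 j) (y i)) * (-1) ^ i"
      using C[OF i] P.equal[OF j] by (simp flip: power_add power_mult_distrib)
  qed
  then have sgn: "eventually (\<lambda>u. \<forall>j\<in>{1..s}. \<forall>i\<in>{..<L}.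
      0 < (\<Sum>k<L. C k * profile (?m u k) (star_family M u j) (y i)) * (-1) ^ i) (at_left 1)"
    by (intro eventually_ball_finite ballI) auto
  \<comment> \<open>The same points serve all short edges; for \<open>u\<close> near 1 the shortened
    edges still contain them.\<close>
  have "eventually (\<lambda>u. y i < star_family M u j) (at_left 1)" if j: "1 \<le> j" "j \<le> s" and i: "i < L" for i j
    by (rule order_tendstoD(1)[OF star_family_tendsto]) (use y_int[OF i] P.equal[OF j] in simp)
  then have len: "eventually (\<lambda>u. \<forall>j\<in>{1..s}. \<forall>i\<in>{..<L}. y i < star_family M u j) (at_left 1)"
    by (intro eventually_ball_finite ballI) auto
  have near: "eventually (\<lambda>u. 0 < u \<and> u \<le> 1) (at_left (1::real))"
    using eventually_at_left_real[of 0 "1::real"] by (auto elim!: eventually_mono)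
  from near long sgn len have "eventually (good_combination s M L C) (at_left 1)"
  proof eventually_elim
    case (elim u)
    interpret Q: short_star s M "star_family M u" by (rule short_star_family) (use s elim in auto)
    have "L \<le> card (zeros 0 (star_family M u j)
         (\<lambda>y. \<Sum>k<L. C k * profile (Q.freq k) (star_family M u j) y)) + 1" if "j \<in> {1..s}" for j
    proof (rule sign_changes_card_zeros[of L y])
      show "continuous_on {0<..<star_family M u j} (\<lambda>y. \<Sum>k<L. C k * profile (Q.freq k) (star_family M u j) y)"
        by (intro continuous_intros profile_cont)
      show "finite (zeros 0 (star_family M u j) (\<lambda>y. \<Sum>k<L. C k * profile (Q.freq k) (star_family M u j) y))"
        using Q.short_edge_zeros(1)[of j L C] that L C0 by simp
    qed (use elim that y_int y_less in auto)
    then show ?case using elim unfolding good_combination_def by blast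
  qed
  then show ?thesis by blast
qed

section \<open>Choice of the parameter\<close>

lemma ex_irrational_powers:
  assumes "eventually P (at_left 1)"
  shows "\<exists>u::real. 0 < u \<and> u < 1 \<and> P u \<and> (\<forall>m\<ge>1. u ^ m \<notin> \<rat>)"
proof -
  obtain b where b: "b < 1" "\<And>y. b < y \<Longrightarrow> y < 1 \<Longrightarrow> P y"
    using assms unfolding eventually_at_left_field by blast
  let ?B = "{u::real. 0 < u \<and> (\<exists>m\<ge>1. u ^ m \<in> \<rat>)}"
  have "?B \<subseteq> (\<Union>m. root m ` \<rat>)"
  proof
    fix u :: real assume "u \<in> ?B"
    then obtain m where m: "0 < u" "m \<ge> 1" "u ^ m \<in> \<rat>" by auto
    then have "u = root m (u ^ m)" by (simp add: real_root_power_cancel)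
    then show "u \<in> (\<Union>m. root m ` \<rat>)" using m by blast
  qed
  moreover have "countable (\<Union>m. root m ` (\<rat> :: real set))"
    using countable_rat by (intro countable_UN countable_image) auto
  ultimately have "countable ?B" by (rule countable_subset)
  moreover have "uncountable {max b 0<..<1}" using b by (simp add: uncountable_open_interval)
  ultimately have "uncountable ({max b 0<..<1} - ?B)" by (rule uncountable_minus_countable[rotated])
  then have "{max b 0<..<1} - ?B \<noteq> {}" by (metis countable_empty)
  then show ?thesis using b by fastforce
qed

text \<open>Ratios of short edges are powers of \<open>u\<close> with nonzero exponent, and those
  with the long edge are such powers up to the rational factor \<open>M + 1\<close>. A single
  parameter thus settles all pairs; inversion covers the opposite order.\<close>

lemma incommensurable_family:
  assumes u: "0 < u" and irr: "\<And>m. m \<ge> 1 \<Longrightarrow> u ^ m \<notin> \<rat>"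
  shows "incommensurable s (star_family M u)"
proof -
  have M: "real M + 1 \<in> \<rat>" "real M + 1 \<noteq> 0" by auto
  have lt: "star_family M u i / star_family M u j \<notin> \<rat>" if "i > j" for i j
  proof
    assume r: "star_family M u i / star_family M u j \<in> \<rat>"
    show False
    proof (cases "j = 0")
      case True
      then have "u ^ i / (real M + 1) \<in> \<rat>" using r that by (simp add: star_family_def)
      then have "u ^ i / (real M + 1) * (real M + 1) \<in> \<rat>" using M(1) by (rule Rats_mult)
      then show False using irr[of i] that M(2) by simp
    next
      case False
      have "u ^ i = u ^ (i - j) * u ^ j" using that by (simp flip: power_add)
      then have "star_family M u i / star_family M u j = u ^ (i - j)"
        using False that u M(2) by (simp add: star_family_def)
      then show False using r irr[of "i - j"] that by simp
    qed
  qed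
  show ?thesis
    unfolding incommensurable_def
  proof (intro allI impI)
    fix i j :: nat assume "i \<noteq> j"
    then consider "i > j" | "j > i" by linarith
    then show "star_family M u i / star_family M u j \<notin> \<rat>"
    proof cases
      case 2
      show ?thesis
      proof
        assume "star_family M u i / star_family M u j \<in> \<rat>"
        then have "inverse (star_family M u i / star_family M u j) \<in> \<rat>" by (rule Rats_inverse)
        then show False using lt[OF 2] by simp
      qed
    qed (rule lt)
  qed
qed

theorem theorem2:
  fixes s M :: nat
  assumes "0 < s" and "0 < M"
  shows "\<exists>l. star_lengths s l \<and> zero_generic s l \<and>
           (\<forall>Lam F. eigen_enumeration s l Lam F \<longrightarrow>
              (\<forall>L. 1 \<le> L \<and> L \<le> M \<longrightarrow>
                 (\<exists>c. has_exactly_zeros s l (\<lambda>j x. \<Sum>k<L. c k * F k j x)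
                        (L - 1 + (L - 1) * (s - 1)))))"
proof -
  have "\<forall>L\<in>{1..M}. \<exists>C. eventually (good_combination s M L C) (at_left 1)"
    using eventually_good_combination[OF assms(1)] by auto
  from bchoice[OF this] obtain C
    where "\<forall>L\<in>{1..M}. eventually (good_combination s M L (C L)) (at_left 1)" ..
  \<comment> \<open>Finitely many \<open>L\<close> occur, so one star serves them all, although each
    \<open>L\<close> has its own coefficients.\<close>
  then have "eventually (\<lambda>u. \<forall>L\<in>{1..M}. good_combination s M L (C L) u) (at_left 1)"
    by (intro eventually_ball_finite) auto
  from ex_irrational_powers[OF this] obtain u where u: "0 < u" "u < 1" "\<forall>m\<ge>1. u ^ m \<notin> \<rat>"
    and good: "\<forall>L\<in>{1..M}. good_combination s M L (C L) u"
    by blast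
  let ?l = "star_family M u"
  interpret Q: short_star s M ?l by (rule short_star_family) (use u assms in auto)
  have inc: "incommensurable s ?l" using u by (intro incommensurable_family) auto
  show ?thesis
  proof (rule exI[of _ ?l], intro conjI allI impI)
    show "star_lengths s ?l" by (rule Q.lengths)
    show "zero_generic s ?l" by (rule zero_generic_incommensurable[OF Q.lengths inc])
    fix Lam F L assume enum: "eigen_enumeration s ?l Lam F" and L: "1 \<le> L \<and> L \<le> M"
    then have "good_combination s M L (C L) u" using good by auto
    then show "\<exists>c. has_exactly_zeros s ?l (\<lambda>j x. \<Sum>k<L. c k * F k j x) (L - 1 + (L - 1) * (s - 1))"
      using L by (intro Q.star_mode_combination_zeros[OF inc enum]) (auto simp: good_combination_def)
  qed
qed

end
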